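(* Let $n\in\mathbb N$, $\alpha_0,\dots,\alpha_n\in\mathbb C$, $\alpha_n\ne0$, let $g\in P'$ have Walsh representation $\sum_{m=0}^\infty d_m\mathrm w_m$, and consider the equation $$\sum_{k=0}^n\alpha_k f^{[k]}=g \qquad ( * )$$ with characteristic polynomial $Q_n(y)=\sum_{k=0}^n\alpha_ky^k$. Then: 1. If $Q_n$ has no non-negative integer roots, then $( * )$ has a unique solution $f=\sum_{m=0}^\infty c_m\mathrm w_m$ in $P'$, where $c_m=d_m/Q_n(m)$. 2. If $\{m_1,\dots,m_r\}$ is the (non-empty) set of non-negative integer roots of $Q_n$ and $\sum_{l=1}^r|d_{m_l}|=0$, then $( * )$ has an $r$-parametric family (enumerated by $c_{m_1},\dots,c_{m_r}$) of solutions in $P'$, $$f(\cdot,c_{m_1},\dots,c_{m_r})=\sum_{m\in\mathbb Z_+}c_m\mathrm w_m,$$ where $c_m=d_m/Q_n(m)$ for $m\ne m_l$, $l=1,\dots,r$, and $c_{m_1},\dots,c_{m_r}$ are arbitrary complex numbers. 3. If $\{m_1,\dots,m_r\}$ is the (non-empty) set of non-negative integer roots of $Q_n$ and $\sum_{l=1}^r|d_{m_l}|\ne0$, then $( * )$ has no solutions in $P'$. Moreover, all solutions from items 1 and 2 are in $L_2^P$ whenever $d_m=O(m^{n-1/2-\varepsilon})$ as $m\to\infty$ for some $\varepsilon>0$, and all solutions from items 1 and 2 are in $C^P$ whenever $d_m=O(m^{n-1-\varepsilon})$ as $m\to\infty$ for some $\varepsilon>0$.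
   Context: $\mathbb N$ = positive integers, $\mathbb Z_+$ = non-negative integers. The Cantor dyadic group $G$ is the set of sequences $x=(x_k)_{k\in\mathbb Z}$, $x_k\in\{0,1\}$, such that $x_k=0$ for all $k$ below some index depending on $x$, with coordinatewise addition modulo 2, denoted $\oplus$; $\mathbf 0$ is the zero sequence. For $x\ne\mathbf 0$ let $N(x)$ be the least $k$ with $x_k=1$ and put $\|x\|=2^{-N(x)-1}$; $\|\mathbf 0\|=0$. The metric is $d(x,y)=\|x\oplus y\|$; $I_n=\{x:\|x\|<2^{-n}\}=\{x: x_k=0\ \forall k<n\}$, $I=I_0$. $dx$ is the Haar measure with $\int_I dx=1$. Let $\lambda(x)=\sum_{j}x_j2^{-j-1}$; restricted to the elements of $G$ that are not eventually equal to 1 (as $k\to+\infty$), $\lambda$ is a bijection onto $[0,\infty)$, and $\lambda^{-1}$ denotes its inverse. For $f:G\to\mathbb C$ and $h\ge0$: $f_{0,h}(x)=f(x\oplus\lambda^{-1}(h))$. A function $f$ on $G$ is 1-periodic if $f(x\oplus\lambda^{-1}(n))=f(x)$ for all $x\in G$, $n\in\mathbb Z_+$. $C^P$ is the space of 1-periodic continuous functions; $L_2^P$ is the space of 1-periodic functions whose restriction to $I$ is in $L_2(I)$. Walsh functions: $\mathrm w_n(x)=(-1)^{\sum_{k\in\mathbb Z}t_kx_{-k-1}}$ with $t=\lambda^{-1}(n)$, $n\in\mathbb Z_+$; they form an orthonormal basis of $L_2^P$. The Gibbs derivative of a function is $f^{[1]}(x)=\lim_{n\to\infty}\sum_{j=-n}^n2^{j-1}(f(x)-f_{0,2^{-j-1}}(x))$,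 with $f^{[0]}=f$, $f^{[n+1]}=(f^{[n]})^{[1]}$; one has $\mathrm w_n^{[1]}=n\mathrm w_n$. $P$ is the space of 1-periodic locally constant functions (equivalently, of Walsh polynomials, i.e. finite linear combinations of the $\mathrm w_k$); a sequence in $P$ converges to $0$ if all its members are constant on every ball of one common fixed radius and it tends to zero uniformly on $I$. $P'$ is the space of continuous linear functionals $f:\phi\mapsto\langle f,\phi\rangle$ on $P$; $f\in P'$ is identified with its Walsh representation, the formal series $\sum_{k=0}^\infty a_k\mathrm w_k$, $a_k=\langle f,\mathrm w_k\rangle$. For $f\in P'$, $f^{[k]}\in P'$ is defined by $\langle f^{[k]},\phi\rangle=\langle f,\phi^{[k]}\rangle$, $\phi\in P$. A 1-periodic function $f$ integrable on $I$ is regarded as an element of $P'$ via $\langle f,\phi\rangle=\int_If\phi\,dx$; "a distribution is in $L_2^P$ (or $C^P$)" means that it is given by such a function. *)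

theory Defs
  imports "HOL-Analysis.Analysis" "HOL-Library.Landau_Symbols" "HOL-Library.FuncSet"
    "HOL-Computational_Algebra.Polynomial"
begin

section \<open>The Cantor dyadic group\<close>

typedef cantor = "{x :: int \<Rightarrow> nat. (\<forall>k. x k \<in> {0, 1}) \<and> (\<exists>K. \<forall>k<K. x k = 0)}"
  morphisms digit Abs_cantor
  by (intro exI[of _ "\<lambda>_. 0"]) auto

lemma digit_0_or_1: "digit x k = 0 \<or> digit x k = 1"
  using digit[of x] by auto

lemma digit_mod2 [simp]: "digit x k mod 2 = digit x k"
  using digit_0_or_1[of x k] by auto

lemma digit_bounded: "\<exists>K. \<forall>k<K. digit x k = 0"
  using digit[of x] by auto

lemma cantor_eqI: "(\<And>k. digit x k = digit y k) \<Longrightarrow> x = y"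
  by (metis digit_inject ext)

instantiation cantor :: ab_group_add
begin

definition zero_cantor :: cantor where
  "0 = Abs_cantor (\<lambda>_. 0)"

definition plus_cantor :: "cantor \<Rightarrow> cantor \<Rightarrow> cantor" where
  "x + y = Abs_cantor (\<lambda>k. (digit x k + digit y k) mod 2)"

(* every element is its own inverse *)
definition uminus_cantor :: "cantor \<Rightarrow> cantor" where
  "- x = (x :: cantor)"

definition minus_cantor :: "cantor \<Rightarrow> cantor \<Rightarrow> cantor" where
  "x - y = (x + y :: cantor)"

lemma digit_zero [simp]: "digit 0 k = 0"
  unfolding zero_cantor_def by (subst Abs_cantor_inverse) auto

lemma digit_plus [simp]: "digit (x + y) k = (digit x k + digit y k) mod 2"
proof -
  obtain K where K: "\<forall>k<K. digit x k = 0" using digit_bounded by blast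
  obtain L where L: "\<forall>k<L. digit y k = 0" using digit_bounded by blast
  have "\<forall>k<min K L. (digit x k + digit y k) mod 2 = 0" using K L by auto
  then have "(\<lambda>k. (digit x k + digit y k) mod 2) \<in>
      {x. (\<forall>k. x k \<in> {0, 1}) \<and> (\<exists>K. \<forall>k<K. x k = 0)}"
    using digit_0_or_1 by (auto intro!: exI[of _ "min K L"])
  then show ?thesis
    unfolding plus_cantor_def by (simp add: Abs_cantor_inverse)
qed

instance
proof
  fix a b c :: cantor
  show "a + b + c = a + (b + c)"
    by (rule cantor_eqI) (simp add: mod_simps add.assoc)
  show "a + b = b + a"
    by (rule cantor_eqI) (simp add: add.commute)
  show "0 + a = a"
    by (rule cantor_eqI) simp
  show "- a + a = 0"
    by (rule cantor_eqI) (simp add: uminus_cantor_def flip: mult_2)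
  show "a - b = a + - b"
    by (simp add: minus_cantor_def uminus_cantor_def)
qed

end

lemma cantor_add_self [simp]: "x + x = (0 :: cantor)"
  by (rule cantor_eqI) (simp flip: mult_2)

definition lead_index :: "cantor \<Rightarrow> int" where
  "lead_index x = (LEAST k. digit x k = 1)"

definition dnorm :: "cantor \<Rightarrow> real" where
  "dnorm x = (if x = 0 then 0 else 2 powi (- lead_index x - 1))"

lemma lead_index:
  assumes "x \<noteq> 0"
  shows "digit x (lead_index x) = 1" "\<And>k. k < lead_index x \<Longrightarrow> digit x k = 0"
proof -
  obtain K where K: "\<forall>k<K. digit x k = 0" using digit_bounded by blast
  have "\<exists>k. digit x k = 1"
    using assms cantor_eqI[of x 0] digit_0_or_1[of x] by fastforce
  then obtain j where j: "digit x j = 1" ..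
  then have "K \<le> j" using K by (metis not_le zero_neq_one)
  define n where "n = (LEAST n::nat. digit x (K + int n) = 1)"
  have ex: "digit x (K + int (nat (j - K))) = 1" using j \<open>K \<le> j\<close> by simp
  have n1: "digit x (K + int n) = 1"
    unfolding n_def by (rule LeastI[of "\<lambda>n. digit x (K + int n) = 1"]) (rule ex)
  have n2: "digit x k = 0" if "k < K + int n" for k
  proof (cases "k < K")
    case False
    then have "nat (k - K) < n" using that by linarith
    then have "digit x (K + int (nat (k - K))) \<noteq> 1"
      unfolding n_def by (rule not_less_Least)
    then show ?thesis using False digit_0_or_1[of x k] by simp
  qed (use K in auto)
  have "lead_index x = K + int n"
    unfolding lead_index_def
    by (rule Least_equality) (use n1 n2 in \<open>auto simp: not_less[symmetric]\<close>)
  then show "digit x (lead_index x) = 1" "\<And>k. k < lead_index x \<Longrightarrow> digit x k = 0"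
    using n1 n2 by auto
qed

lemma dnorm_less_iff: "dnorm (x :: cantor) < 2 powi (- n) \<longleftrightarrow> (\<forall>k<n. digit x k = 0)"
proof (cases "x = 0")
  case False
  have "dnorm x < 2 powi (- n) \<longleftrightarrow> n \<le> lead_index x"
    using False power_int_strict_increasing[of "- lead_index x - 1" "- n" "2::real"]
      power_int_increasing[of "- n" "- lead_index x - 1" "2::real"]
    by (auto simp: dnorm_def not_less[symmetric])
  also have "\<dots> \<longleftrightarrow> (\<forall>k<n. digit x k = 0)"
    using lead_index[OF False] by (metis less_le_trans not_le zero_neq_one)
  finally show ?thesis .
qed (simp add: dnorm_def)

lemma dnorm_nonneg: "dnorm (x :: cantor) \<ge> 0"
  by (simp add: dnorm_def)

instantiation cantor :: metric_space
begin

definition dist_cantor :: "cantor \<Rightarrow> cantor \<Rightarrow> real" where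
  "dist x y = dnorm (x + y)"

definition uniformity_cantor :: "(cantor \<times> cantor) filter" where
  "uniformity = (INF e\<in>{0<..}. principal {(x :: cantor, y). dist x y < e})"

definition open_cantor :: "cantor set \<Rightarrow> bool" where
  "open (U :: cantor set) = (\<forall>x\<in>U. eventually (\<lambda>(x', y). x' = x \<longrightarrow> y \<in> U) uniformity)"

instance
proof
  show "uniformity = (INF e\<in>{0<..}. principal {(x :: cantor, y). dist x y < e})"
    by (rule uniformity_cantor_def)
  show "open U = (\<forall>x\<in>U. eventually (\<lambda>(x', y). x' = x \<longrightarrow> y \<in> U) uniformity)" for U :: "cantor set"
    by (rule open_cantor_def)
  fix x y z :: cantor
  have "x + y = 0 \<longleftrightarrow> x = y"
    by (metis cantor_add_self add_left_cancel)
  then show "dist x y = 0 \<longleftrightarrow> x = y"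
    by (simp add: dist_cantor_def dnorm_def)
  show "dist x y \<le> dist x z + dist y z"
  proof (rule ccontr)
    define a b where "a = x + z" and "b = y + z"
    have ab: "x + y = a + b"
      by (rule cantor_eqI) (simp add: a_def b_def mod_simps, presburger)
    assume "\<not> ?thesis"
    then have *: "dnorm a < dnorm (a + b)" "dnorm b < dnorm (a + b)"
      using dnorm_nonneg[of a] dnorm_nonneg[of b] ab
      by (auto simp: dist_cantor_def a_def b_def)
    then have nz: "a + b \<noteq> 0"
      using dnorm_nonneg[of a] by (auto simp: dnorm_def)
    define N where "N = lead_index (a + b)"
    have "dnorm (a + b) = 2 powi (- (N + 1))"
      using nz by (simp add: dnorm_def N_def)
    then have "digit a N = 0" "digit b N = 0"
      using * dnorm_less_iff[of a "N + 1"] dnorm_less_iff[of b "N + 1"] by auto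
    then show False
      using lead_index(1)[OF nz] by (simp add: N_def)
  qed
qed

end

definition unit_ball :: "cantor set" where
  "unit_ball = {x. dnorm x < 1}"

section \<open>Haar measure\<close>

definition is_haar :: "cantor measure \<Rightarrow> bool" where
  "is_haar M \<longleftrightarrow> sets M = sets borel \<and> (\<forall>a. distr M borel (\<lambda>x. a + x) = M) \<and> emeasure M unit_ball = 1"

definition haar :: "cantor measure" where
  "haar = (THE M. is_haar M)"

(* cosets of the balls of radius 2 powi (-n) around 0 *)
definition cyl :: "cantor \<Rightarrow> int \<Rightarrow> cantor set" where
  "cyl x n = {y. \<forall>k<n. digit y k = digit x k}"

lemma digit_sum_eq_0_iff: "digit (x + y) k = 0 \<longleftrightarrow> digit x k = digit y k"
  using digit_0_or_1[of x k] digit_0_or_1[of y k] by auto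

lemma cyl_eq_ball: "cyl x n = ball x (2 powi (- n))"
  unfolding cyl_def ball_def dist_cantor_def
  by (auto simp: dnorm_less_iff digit_sum_eq_0_iff simp del: digit_plus)

lemma unit_ball_eq_cyl: "unit_ball = cyl 0 0"
  unfolding unit_ball_def cyl_def using dnorm_less_iff[of _ 0] by simp

lemma open_cyl [simp]: "open (cyl x n)"
  by (simp add: cyl_eq_ball)

lemma cyl_subset_or_disjoint:
  assumes "m \<le> n"
  shows "cyl y n \<subseteq> cyl x m \<or> cyl x m \<inter> cyl y n = {}"
  using assms unfolding cyl_def by (force dest: order_less_le_trans)

lemma Int_stable_cyl: "Int_stable (insert {} (range (\<lambda>(x, n). cyl x n)))"
proof (rule Int_stableI)
  fix A B
  assume A: "A \<in> insert {} (range (\<lambda>(x, n). cyl x n))" and B: "B \<in> insert {} (range (\<lambda>(x, n). cyl x n))"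
  show "A \<inter> B \<in> insert {} (range (\<lambda>(x, n). cyl x n))"
  proof (cases "A = {} \<or> B = {}")
    case False
    then obtain x m y n where *: "A = cyl x m" "B = cyl y n" using A B by auto
    have "A \<inter> B = {} \<or> A \<inter> B = A \<or> A \<inter> B = B"
      using cyl_subset_or_disjoint[of m n y x] cyl_subset_or_disjoint[of n m x y] * by fastforce
    then show ?thesis using A B by auto
  qed auto
qed

lemma countable_cyl: "countable (range (\<lambda>(x, n). cyl x n))"
proof -
  define g where "g = (\<lambda>(S :: int set, n). {y. \<forall>k<n. digit y k = of_bool (k \<in> S)})"
  have "range (\<lambda>(x, n). cyl x n) \<subseteq> g ` ({S. finite S} \<times> UNIV)"
  proof safe
    fix x n
    define S where "S = {k. k < n \<and> digit x k = 1}"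
    obtain K where K: "\<forall>k<K. digit x k = 0" using digit_bounded by blast
    have "S \<subseteq> {K..n}" using K by (force simp: S_def not_less[symmetric])
    then have "finite S" by (rule finite_subset) simp
    moreover have "cyl x n = g (S, n)"
      using digit_0_or_1[of x] unfolding cyl_def g_def S_def by fastforce
    ultimately show "cyl x n \<in> g ` ({S. finite S} \<times> UNIV)" by blast
  qed
  moreover have "countable (g ` ({S. finite S} \<times> UNIV))"
    by (intro countable_image countable_SIGMA countable_Collect_finite) auto
  ultimately show ?thesis by (rule countable_subset)
qed

lemma open_eq_Union_cyl:
  assumes "open U"
  shows "U = \<Union>{C \<in> range (\<lambda>(x, n). cyl x n). C \<subseteq> U}"
proof (intro equalityI subsetI)
  fix x assume "x \<in> U"
  then obtain e where e: "e > 0" "ball x e \<subseteq> U" using assms open_contains_ball by blast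
  obtain n :: nat where n: "(1/2) ^ n < e"
    using real_arch_pow_inv[of e "1/2"] e by auto
  have "(2::real) powi (- int n) = (1/2) ^ n"
    by (simp add: power_int_minus power_one_over field_simps)
  then have "cyl x (int n) \<subseteq> U"
    using n e by (auto simp: cyl_eq_ball)
  moreover have "x \<in> cyl x (int n)" by (simp add: cyl_def)
  ultimately show "x \<in> \<Union>{C \<in> range (\<lambda>(x, n). cyl x n). C \<subseteq> U}" by blast
qed auto

lemma sets_borel_cantor:
  "sets (borel :: cantor measure) = sigma_sets UNIV (insert {} (range (\<lambda>(x, n). cyl x n)))"
    (is "_ = sigma_sets UNIV ?E")
proof (rule equalityI)
  interpret S: sigma_algebra UNIV "sigma_sets UNIV ?E" by (rule sigma_algebra_sigma_sets) simp
  have "U \<in> sigma_sets UNIV ?E" if "open U" for U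
  proof -
    have "\<Union>{C \<in> range (\<lambda>(x, n). cyl x n). C \<subseteq> U} \<in> sigma_sets UNIV ?E"
      by (rule S.countable_Union) (auto intro: countable_subset[OF _ countable_cyl])
    then show ?thesis using open_eq_Union_cyl[OF that] by simp
  qed
  then show "sets borel \<subseteq> sigma_sets UNIV ?E"
    unfolding sets_borel by (intro S.sigma_sets_subset) auto
  show "sigma_sets UNIV ?E \<subseteq> sets borel"
    unfolding sets_borel by (intro sigma_sets_mono') auto
qed

lemma measure_eqI_cyl:
  assumes "sets M = sets borel" "sets N = sets borel"
    and "\<And>x n. emeasure M (cyl x n) = ennreal (2 powi (- n))"
    and "\<And>x n. emeasure N (cyl x n) = ennreal (2 powi (- n))"
  shows "M = N"
proof (rule measure_eqI_generator_eq[OF Int_stable_cyl, where \<Omega> = UNIV and A = "\<lambda>i. cyl 0 (- int i)"])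
  show "(\<Union>i. cyl 0 (- int i)) = UNIV"
  proof (intro equalityI subsetI)
    fix x :: cantor
    obtain K where K: "\<forall>k<K. digit x k = 0" using digit_bounded by blast
    then have "x \<in> cyl 0 (- int (nat (- K)))" by (auto simp: cyl_def)
    then show "x \<in> (\<Union>i. cyl 0 (- int i))" by blast
  qed auto
qed (use assms sets_borel_cantor in auto)

lemma continuous_on_cantor_translate: "continuous_on UNIV (\<lambda>x :: cantor. a + x)"
proof -
  have "dist (a + x) (a + y) = dist x y" for x y
  proof -
    have "(a + x) + (a + y) = x + y"
      by (rule cantor_eqI) (simp add: mod_simps, presburger)
    then show ?thesis by (simp only: dist_cantor_def)
  qed
  then show ?thesis by (auto simp: continuous_on_iff)
qed

lemma measurable_cantor_translate [measurable]: "(\<lambda>x :: cantor. a + x) \<in> borel_measurable borel"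
  using continuous_on_cantor_translate by (rule borel_measurable_continuous_onI)

lemma vimage_translate_cyl: "(\<lambda>y. a + y) -` cyl x n = cyl (a + x) n"
proof -
  have "digit (a + y) k = digit x k \<longleftrightarrow> digit y k = digit (a + x) k" for y k
    using digit_0_or_1[of a k] digit_0_or_1[of x k] digit_0_or_1[of y k] by auto
  then show ?thesis unfolding cyl_def by (auto simp del: digit_plus)
qed

lemma is_haar_cyl:
  assumes "is_haar M"
  shows "emeasure M (cyl x n) = ennreal (2 powi (- n))"
proof -
  have sM [measurable_cong]: "sets M = sets borel" and inv: "\<And>a. distr M borel (\<lambda>x. a + x) = M"
    and one: "emeasure M (cyl 0 0) = 1"
    using assms by (auto simp: is_haar_def unit_ball_eq_cyl)
  have spM: "space M = UNIV" using sets_eq_imp_space_eq[OF sM] by simp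
  have cyl_in [simp]: "cyl y n \<in> sets M" for y n by (simp add: sM)
  have tr: "emeasure M (cyl y n) = emeasure M (cyl 0 n)" for y n
  proof -
    have "emeasure M (cyl y n) = emeasure (distr M borel (\<lambda>x. y + x)) (cyl y n)" by (simp add: inv)
    also have "\<dots> = emeasure M (cyl (y + y) n)"
      by (subst emeasure_distr) (simp_all add: vimage_translate_cyl spM)
    finally show ?thesis by simp
  qed
  have half: "emeasure M (cyl 0 n) = 2 * emeasure M (cyl 0 (n + 1))" for n
  proof -
    define e where "e = Abs_cantor (\<lambda>k. of_bool (k = n))"
    have e: "digit e k = of_bool (k = n)" for k
      unfolding e_def by (subst Abs_cantor_inverse) (auto intro!: exI[of _ n])
    have "cyl 0 n = cyl 0 (n + 1) \<union> cyl e (n + 1)"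
    proof (intro equalityI subsetI)
      fix x assume x: "x \<in> cyl 0 n"
      show "x \<in> cyl 0 (n + 1) \<union> cyl e (n + 1)"
        using x digit_0_or_1[of x n] by (auto simp: cyl_def e zless_add1_eq order_le_less)
    qed (auto simp: cyl_def e)
    moreover have "cyl 0 (n + 1) \<inter> cyl e (n + 1) = {}"
      unfolding cyl_def by (auto simp: e intro!: exI[of _ n])
    ultimately have "emeasure M (cyl 0 n) = emeasure M (cyl 0 (n + 1)) + emeasure M (cyl e (n + 1))"
      using plus_emeasure[of "cyl 0 (n + 1)" M "cyl e (n + 1)"] by simp
    then show ?thesis by (simp add: tr[of e] mult_2)
  qed
  have pos: "emeasure M (cyl 0 (int j)) = ennreal (2 powi (- int j))" for j :: nat
  proof (induction j)
    case (Suc j)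
    have "2 * emeasure M (cyl 0 (int (Suc j))) = ennreal (2 powi (- int j))"
      using half[of "int j"] Suc by (simp add: add.commute)
    also have "(2::real) powi (- int j) = 2 * 2 powi (- int (Suc j))"
      using power_int_add_1[of "2::real" "- int (Suc j)"] by simp
    also have "ennreal \<dots> = 2 * ennreal (2 powi (- int (Suc j)))"
      by (simp add: ennreal_mult)
    finally show ?case by (simp add: ennreal_mult_cancel_left)
  qed (use one in simp)
  have neg: "emeasure M (cyl 0 (- int j)) = ennreal (2 ^ j)" for j :: nat
  proof (induction j)
    case (Suc j)
    then show ?case
      using half[of "- int (Suc j)"] by (simp add: ennreal_mult)
  qed (use one in simp)
  have "emeasure M (cyl 0 n) = ennreal (2 powi (- n))"
    using pos[of "nat n"] neg[of "nat (- n)"] by (cases "n \<ge> 0") (simp_all add: power_int_def)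
  then show ?thesis by (simp add: tr[of x])
qed

(* Existence: the binary digits of Lebesgue-distributed reals. *)

definition binary_expansion :: "real \<Rightarrow> cantor" where
  "binary_expansion h = Abs_cantor (\<lambda>k. nat (\<lfloor>h * 2 powi (k + 1)\<rfloor> mod 2))"

lemma digit_binary_expansion:
  assumes "h \<ge> 0"
  shows "digit (binary_expansion h) k = nat (\<lfloor>h * 2 powi (k + 1)\<rfloor> mod 2)"
proof -
  obtain n :: nat where n: "h < 2 ^ n" using real_arch_pow[of 2 h] by auto
  have "nat (\<lfloor>h * 2 powi (k + 1)\<rfloor> mod 2) = 0" if "k < - int n" for k
  proof -
    have "h * 2 powi (k + 1) \<le> h * 2 powi (- int n)"
      using that assms by (intro mult_left_mono power_int_increasing) auto
    also have "\<dots> < 1" using n by (simp add: power_int_minus field_simps)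
    finally have "\<lfloor>h * 2 powi (k + 1)\<rfloor> = 0" using assms by (simp add: floor_eq_iff)
    then show ?thesis by simp
  qed
  moreover have "nat (i mod 2) \<in> {0, 1}" for i :: int
    by (cases "even i") (auto simp: odd_iff_mod_2_eq_one)
  ultimately have "(\<lambda>k. nat (\<lfloor>h * 2 powi (k + 1)\<rfloor> mod 2)) \<in>
      {x. (\<forall>k. x k \<in> {0, 1}) \<and> (\<exists>K. \<forall>k<K. x k = 0)}"
    by blast
  then show ?thesis unfolding binary_expansion_def by (simp add: Abs_cantor_inverse)
qed

lemma floor_double_div2: "\<lfloor>(h::real) * 2 powi n\<rfloor> = \<lfloor>h * 2 powi (n + 1)\<rfloor> div 2"
proof -
  have "h * 2 powi n = (h * 2 powi (n + 1)) / 2" by (simp add: power_int_add_1)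
  then show ?thesis using floor_divide_real_eq_div[of 2 "h * 2 powi (n + 1)"] by (simp only:) simp
qed

lemma binary_expansion_vimage_cyl:
  "\<exists>m::int. m \<ge> 0 \<and> {h. h \<ge> 0 \<and> binary_expansion h \<in> cyl x n} = {h. \<lfloor>h * 2 powi n\<rfloor> = m}"
proof -
  obtain K where K: "\<forall>k<K. digit x k = 0" using digit_bounded by blast
  define N where "N = min K n"
  have N: "\<forall>k<N. digit x k = 0" "N \<le> n" using K by (auto simp: N_def)
  from N(2) show ?thesis
  proof (induction n rule: int_ge_induct)
    case base
    have "(h \<ge> 0 \<and> binary_expansion h \<in> cyl x N) \<longleftrightarrow> \<lfloor>h * 2 powi N\<rfloor> = 0" (is "?L \<longleftrightarrow> ?R") for h
    proof
      assume ?L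
      then have h: "h \<ge> 0" and ev: "\<And>k. k < N \<Longrightarrow> even \<lfloor>h * 2 powi (k + 1)\<rfloor>"
        using N(1) digit_binary_expansion[of h] by (auto simp: cyl_def even_iff_mod_2_eq_zero)
      have shift: "\<lfloor>h * 2 powi (N - int j)\<rfloor> = \<lfloor>h * 2 powi N\<rfloor> div 2 ^ j" for j
      proof (induction j)
        case (Suc j)
        have "\<lfloor>h * 2 powi (N - int (Suc j))\<rfloor> = \<lfloor>h * 2 powi (N - int j)\<rfloor> div 2"
          using floor_double_div2[of h "N - int (Suc j)"] by (simp add: algebra_simps)
        also have "\<dots> = \<lfloor>h * 2 powi N\<rfloor> div (2 ^ j * 2)" using Suc by (simp only: zdiv_zmult2_eq)
        finally show ?case by (simp only: power_Suc2)
      qed simp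
      show ?R
      proof (rule bit_eqI)
        fix j
        show "bit \<lfloor>h * 2 powi N\<rfloor> j = bit 0 j"
          using ev[of "N - int j - 1"] shift[of j] by (simp add: bit_iff_odd)
      qed
    next
      assume R: ?R
      then have "h * 2 powi N \<ge> 0" by (simp add: floor_eq_iff)
      then have h: "h \<ge> 0"
        using zero_less_power_int[of "2::real" N] 
          by (metis mult_neg_pos not_le zero_less_numeral)
      have "\<lfloor>h * 2 powi (k + 1)\<rfloor> = 0" if "k < N" for k
      proof -
        have "h * 2 powi (k + 1) \<le> h * 2 powi N"
          using that h by (intro mult_left_mono power_int_increasing) auto
        then show ?thesis using R h by (simp add: floor_eq_iff)
      qed
      then show ?L using h N(1) by (simp add: cyl_def digit_binary_expansion)
    qed
    then show ?case by (intro exI[of _ 0]) auto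
  next
    case (step n)
    then obtain m where m: "m \<ge> 0" "{h. h \<ge> 0 \<and> binary_expansion h \<in> cyl x n} = {h. \<lfloor>h * 2 powi n\<rfloor> = m}"
      by blast
    have mh: "(h \<ge> 0 \<and> binary_expansion h \<in> cyl x n) \<longleftrightarrow> \<lfloor>h * 2 powi n\<rfloor> = m" for h
      using m(2) by (simp add: set_eq_iff)
    have "(h \<ge> 0 \<and> binary_expansion h \<in> cyl x (n + 1)) \<longleftrightarrow> \<lfloor>h * 2 powi (n + 1)\<rfloor> = 2 * m + int (digit x n)" for h
    proof -
      have "(h \<ge> 0 \<and> binary_expansion h \<in> cyl x (n + 1)) \<longleftrightarrow>
          (h \<ge> 0 \<and> binary_expansion h \<in> cyl x n) \<and> digit (binary_expansion h) n = digit x n"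
        unfolding cyl_def by (auto simp: order_le_less)
      also have "\<dots> \<longleftrightarrow> (h \<ge> 0 \<and> \<lfloor>h * 2 powi n\<rfloor> = m) \<and> nat (\<lfloor>h * 2 powi (n + 1)\<rfloor> mod 2) = digit x n"
        using mh[of h] digit_binary_expansion[of h n] by (cases "h \<ge> 0") simp_all
      also have "\<dots> \<longleftrightarrow> (h \<ge> 0 \<and> \<lfloor>h * 2 powi (n + 1)\<rfloor> div 2 = m) \<and> \<lfloor>h * 2 powi (n + 1)\<rfloor> mod 2 = int (digit x n)"
        by (auto simp: floor_double_div2[of h n] nat_eq_iff)
      also have "\<dots> \<longleftrightarrow> h \<ge> 0 \<and> \<lfloor>h * 2 powi (n + 1)\<rfloor> = 2 * m + int (digit x n)"
      proof -
        have "(q div 2 = m \<and> q mod 2 = int b) \<longleftrightarrow> q = 2 * m + int b" if "b = 0 \<or> b = 1" for q :: int and b :: nat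
          using that by presburger
        from this[OF digit_0_or_1] show ?thesis by blast
      qed
      also have "\<dots> \<longleftrightarrow> \<lfloor>h * 2 powi (n + 1)\<rfloor> = 2 * m + int (digit x n)"
      proof -
        have "h \<ge> 0" if "\<lfloor>h * 2 powi (n + 1)\<rfloor> = 2 * m + int (digit x n)"
        proof -
          have "0 \<le> \<lfloor>h * 2 powi (n + 1)\<rfloor>" using that m(1) by simp
          then have "0 \<le> h * 2 powi (n + 1)" by (simp add: zero_le_floor)
          then show ?thesis
            using zero_less_power_int[of "2::real" "n + 1"] 
          by (metis mult_neg_pos not_le zero_less_numeral)
        qed
        then show ?thesis by blast
      qed
      finally show ?thesis .
    qed
    then show ?case using m(1) by (intro exI[of _ "2 * m + int (digit x n)"]) auto
  qed
qed

lemma is_haar_ex: "\<exists>M. is_haar M"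
proof -
  define L where "L = restrict_space (lborel :: real measure) {0..}"
  have spL: "space L = {0..}" by (simp add: L_def space_restrict_space)
  have vim: "binary_expansion -` cyl x n \<inter> space L \<in> sets L \<and>
      emeasure L (binary_expansion -` cyl x n \<inter> space L) = ennreal (2 powi (- n))" for x n
  proof -
    obtain m :: int where m: "m \<ge> 0" "{h. h \<ge> 0 \<and> binary_expansion h \<in> cyl x n} = {h. \<lfloor>h * 2 powi n\<rfloor> = m}"
      using binary_expansion_vimage_cyl by blast
    have "binary_expansion -` cyl x n \<inter> space L = {h. h \<ge> 0 \<and> binary_expansion h \<in> cyl x n}"
      using spL by auto
    also have "\<dots> = {of_int m * 2 powi (- n) ..< (of_int m + 1) * 2 powi (- n)}"
      unfolding m(2) by (auto simp: floor_eq_iff power_int_minus field_simps)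
    finally have eq: "binary_expansion -` cyl x n \<inter> space L = \<dots>" .
    have sub: "{of_int m * 2 powi (- n) ..< (of_int m + 1) * 2 powi (- n)} \<subseteq> {0::real..}"
      using m(1) by (auto intro: order_trans[rotated])
    have "emeasure L {of_int m * 2 powi (- n) ..< (of_int m + 1) * 2 powi (- n)} =
        ennreal ((of_int m + 1) * 2 powi (- n) - of_int m * 2 powi (- n))"
      unfolding L_def using sub by (subst emeasure_restrict_space) (auto simp: mult_right_mono)
    also have "\<dots> = ennreal (2 powi (- n))" by (simp add: algebra_simps)
    finally show ?thesis
      unfolding eq using sub by (auto simp: L_def sets_restrict_space_iff)
  qed
  have meas [measurable]: "binary_expansion \<in> measurable L borel"
  proof (rule measurableI)
    fix A :: "cantor set" assume "A \<in> sets borel"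
    then have "A \<in> sigma_sets UNIV (insert {} (range (\<lambda>(x, n). cyl x n)))"
      by (simp add: sets_borel_cantor)
    then show "binary_expansion -` A \<inter> space L \<in> sets L"
    proof induction
      case (Compl a)
      have "binary_expansion -` (UNIV - a) \<inter> space L = space L - (binary_expansion -` a \<inter> space L)" by auto
      then show ?case using Compl by auto
    next
      case (Union a)
      have "binary_expansion -` (\<Union>i. a i) \<inter> space L = (\<Union>i. binary_expansion -` a i \<inter> space L)" by auto
      moreover have "(\<Union>i. binary_expansion -` a i \<inter> space L) \<in> sets L"
        using Union by (intro sets.countable_UN) auto
      ultimately show ?case by (simp only:)
    qed (use vim in auto)
  qed simp
  define M where "M = distr L borel binary_expansion"
  have M: "emeasure M (cyl x n) = ennreal (2 powi (- n))" for x n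
    unfolding M_def using vim by (subst emeasure_distr) auto
  have sM [measurable_cong]: "sets M = sets borel" by (simp add: M_def)
  have "distr M borel (\<lambda>x. a + x) = M" for a
  proof (rule measure_eqI_cyl)
    show "emeasure (distr M borel (\<lambda>x. a + x)) (cyl x n) = ennreal (2 powi (- n))" for x n
      by (subst emeasure_distr) (simp_all add: vimage_translate_cyl M sets_eq_imp_space_eq[OF sM])
  qed (simp_all add: sM M)
  then have "is_haar M"
    using M[of 0 0] by (simp add: is_haar_def sM unit_ball_eq_cyl)
  then show ?thesis ..
qed

lemma is_haar_haar: "is_haar haar"
  unfolding haar_def
proof (rule theI')
  show "\<exists>!M. is_haar M"
    using is_haar_ex is_haar_cyl by (auto intro!: measure_eqI_cyl simp: is_haar_def)
qed

section \<open>Periodic functions and the Gibbs derivative\<close>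

definition lam :: "cantor \<Rightarrow> real" where
  "lam x = (\<Sum>\<^sub>\<infinity>j\<in>UNIV. real (digit x j) * 2 powi (- j - 1))"

definition lam_inv :: "real \<Rightarrow> cantor" where
  "lam_inv = the_inv_into {x. \<not> (\<exists>K. \<forall>k\<ge>K. digit x k = 1)} lam"

definition shift :: "real \<Rightarrow> (cantor \<Rightarrow> complex) \<Rightarrow> cantor \<Rightarrow> complex" where
  "shift h f x = f (x + lam_inv h)"

definition periodic1 :: "(cantor \<Rightarrow> complex) \<Rightarrow> bool" where
  "periodic1 f \<longleftrightarrow> (\<forall>x. \<forall>n::nat. f (x + lam_inv (real n)) = f x)"

definition C_P :: "(cantor \<Rightarrow> complex) set" where
  "C_P = {f. periodic1 f \<and> continuous_on UNIV f}"

definition L2_P :: "(cantor \<Rightarrow> complex) set" where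
  "L2_P = {f. periodic1 f \<and> set_borel_measurable haar unit_ball f \<and>
              set_integrable haar unit_ball (\<lambda>x. (cmod (f x))\<^sup>2)}"

(* Only finitely many terms of the exponent are non-zero. *)
definition walsh :: "nat \<Rightarrow> cantor \<Rightarrow> complex" where
  "walsh n x = (let t = lam_inv (real n) in
     (-1) ^ (\<Sum>k | digit t k * digit x (- k - 1) \<noteq> 0. digit t k * digit x (- k - 1)))"

(* Pointwise limit; on test_P the partial sums are eventually constant, elsewhere lim may be
   unspecified. *)
definition gibbs :: "(cantor \<Rightarrow> complex) \<Rightarrow> cantor \<Rightarrow> complex" where
  "gibbs f x = lim (\<lambda>n::nat. \<Sum>j = - int n..int n.
     2 powi (j - 1) * (f x - shift (2 powi (- j - 1)) f x))"

section \<open>Test functions and distributions\<close>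

definition test_P :: "(cantor \<Rightarrow> complex) set" where
  "test_P = {\<phi>. periodic1 \<phi> \<and> (\<forall>x. \<exists>U. open U \<and> x \<in> U \<and> \<phi> constant_on U)}"

definition null_seq_P :: "(nat \<Rightarrow> cantor \<Rightarrow> complex) \<Rightarrow> bool" where
  "null_seq_P \<phi> \<longleftrightarrow> (\<forall>j. \<phi> j \<in> test_P) \<and>
     (\<exists>r>0. \<forall>j x. \<phi> j constant_on ball x r) \<and>
     uniform_limit unit_ball \<phi> (\<lambda>_. 0) sequentially"

(* Functionals are taken extensional, so that equality in dist_P is equality on test_P. *)
definition dist_P :: "((cantor \<Rightarrow> complex) \<Rightarrow> complex) set" where
  "dist_P = {F \<in> extensional test_P.
     (\<forall>\<phi>\<in>test_P. \<forall>\<psi>\<in>test_P. F (\<lambda>x. \<phi> x + \<psi> x) = F \<phi> + F \<psi>) \<and>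
     (\<forall>c. \<forall>\<phi>\<in>test_P. F (\<lambda>x. c * \<phi> x) = c * F \<phi>) \<and>
     (\<forall>\<phi>. null_seq_P \<phi> \<longrightarrow> (\<lambda>j. F (\<phi> j)) \<longlonglongrightarrow> 0)}"

definition has_walsh_rep :: "((cantor \<Rightarrow> complex) \<Rightarrow> complex) \<Rightarrow> (nat \<Rightarrow> complex) \<Rightarrow> bool" where
  "has_walsh_rep F a \<longleftrightarrow> F \<in> dist_P \<and> (\<forall>k. F (walsh k) = a k)"

definition gibbs_dist :: "nat \<Rightarrow> ((cantor \<Rightarrow> complex) \<Rightarrow> complex) \<Rightarrow> (cantor \<Rightarrow> complex) \<Rightarrow> complex" where
  "gibbs_dist k F = (\<lambda>\<phi>\<in>test_P. F ((gibbs ^^ k) \<phi>))"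

definition regular_dist :: "(cantor \<Rightarrow> complex) \<Rightarrow> (cantor \<Rightarrow> complex) \<Rightarrow> complex" where
  "regular_dist u = (\<lambda>\<phi>\<in>test_P. LINT x:unit_ball|haar. u x * \<phi> x)"

definition charpoly :: "nat \<Rightarrow> (nat \<Rightarrow> complex) \<Rightarrow> complex poly" where
  "charpoly n \<alpha> = (\<Sum>k\<le>n. monom (\<alpha> k) k)"

definition solutions ::
  "nat \<Rightarrow> (nat \<Rightarrow> complex) \<Rightarrow> ((cantor \<Rightarrow> complex) \<Rightarrow> complex) \<Rightarrow> ((cantor \<Rightarrow> complex) \<Rightarrow> complex) set" where
  "solutions n \<alpha> g = {F \<in> dist_P. (\<lambda>\<phi>\<in>test_P. \<Sum>k\<le>n. \<alpha> k * gibbs_dist k F \<phi>) = g}"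

end

theory Submission
  imports Defs
begin

text \<open>Test functions are exactly the Walsh polynomials, so a distribution is an arbitrary coefficient
  sequence, and since \<open>w\<^sub>m\<close> is an eigenfunction of the Gibbs derivative with eigenvalue \<open>m\<close>, the
  equation decouples into \<open>Q(m) c\<^sub>m = d\<^sub>m\<close>. For the regularity claims, \<open>|Q(m)|\<close> grows like \<open>m\<^sup>n\<close>, which
  makes the \<open>c\<^sub>m\<close> absolutely summable (\<open>C\<^sup>P\<close>) or square summable with geometrically decaying
  dyadic blocks (\<open>L\<^sub>2\<^sup>P\<close>).\<close>

section \<open>Binary digits and Walsh characters\<close>

text \<open>\<open>lam_inv\<close> and the \<open>lim\<close> in \<open>gibbs\<close> are total
  functions with unspecified values off their proper domains, so each is evaluated only where a
  value is forced: \<open>lam_inv\<close> at natural numbers and powers of two, through injectivity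
  of \<open>lam\<close> and an explicit preimage with finitely many digits, and \<open>gibbs\<close>
  on Walsh polynomials. The main obstacle is that \<open>test_P\<close> asks for local constancy
  with a neighbourhood chosen per point, whereas a Walsh polynomial depends on a fixed number of
  digits. The uniform level comes from a compactness argument on the unit ball, carried to the whole
  group by periodicity. At roots of the characteristic polynomial the coefficients of a solution are
  free, but there are finitely many of them, so a larger constant absorbs them in the decay
  estimate.\<close>

abbreviation digit_weight :: "cantor \<Rightarrow> int \<Rightarrow> real" where
  "digit_weight x j \<equiv> real (digit x j) * 2 powi (- j - 1)"

lemma digit_eq_1: "0 < digit x k \<Longrightarrow> digit x k = 1"
  using digit_0_or_1[of x k] by auto

lemma digit_le_1: "digit x k \<le> 1"
  using digit_0_or_1[of x k] by auto

lemma cyl_Suc: "y \<in> cyl x (int (Suc n)) \<longleftrightarrow> y \<in> cyl x (int n) \<and> digit y (int n) = digit x (int n)"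
proof -
  have "k < int (Suc n) \<longleftrightarrow> k < int n \<or> k = int n" for k by auto
  then show ?thesis by (auto simp: cyl_def)
qed

text \<open>A geometric series: all digits from N on together weigh as much as digit
  \<open>N - 1\<close> alone, which is the source of ambiguous binary expansions.\<close>

lemma has_sum_powi_tail: "((\<lambda>j::int. 2 powi (- j - 1) :: real) has_sum 2 powi (- N)) {N..}"
proof -
  have "(\<lambda>n::nat. 2 powi (- N) * (1/2) ^ Suc n :: real) sums (2 powi (- N) * 1)"
    by (intro sums_mult power_half_series)
  then have "((\<lambda>n::nat. 2 powi (- N) * (1/2) ^ Suc n :: real) has_sum 2 powi (- N)) UNIV"
    by (intro sums_nonneg_imp_has_sum) auto
  also have "?this \<longleftrightarrow> ?thesis"
  proof (rule has_sum_reindex_bij_witness[of _ "\<lambda>j. nat (j - N)" "\<lambda>n. N + int n"])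
    fix n :: nat
    have "- (N + int n) - 1 = - N + - int (Suc n)" by simp
    moreover have "(2::real) powi (- N + - int (Suc n)) = 2 powi (- N) * 2 powi (- int (Suc n))"
      by (rule power_int_add) simp
    ultimately have "(2::real) powi (- (N + int n) - 1) = 2 powi (- N) * 2 powi (- int (Suc n))"
      by (simp only:)
    then show "(2::real) powi (- (N + int n) - 1) = 2 powi (- N) * (1/2) ^ Suc n"
      by (simp add: power_int_minus power_one_over field_simps del: of_nat_Suc)
  qed auto
  finally show ?thesis .
qed

lemma summable_digit_weight: "digit_weight x summable_on A"
proof -
  obtain K where K: "\<forall>k<K. digit x k = 0" using digit_bounded by blast
  have "(\<lambda>j. 2 powi (- j - 1) :: real) summable_on {K..}"
    using has_sum_powi_tail has_sum_imp_summable by blast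
  then have "digit_weight x summable_on {K..}"
    by (rule summable_on_comparison_test) (use digit_le_1[of x] in auto)
  then have "digit_weight x summable_on UNIV"
    using K by (subst summable_on_cong_neutral[where T = "{K..}"]) auto
  then show ?thesis by (rule summable_on_subset_banach) simp
qed

text \<open>The first differing digit decides. Digit N weighs exactly as much as all later digits
  together, so y could only draw level with a tail of ones, and the later zero \<open>j0\<close>
  prevents that.\<close>

lemma lam_strict_mono:
  assumes eq: "\<And>j. j < N \<Longrightarrow> digit x j = digit y j" and N: "digit x N = 1" "digit y N = 0"
    and y: "\<not> (\<exists>K. \<forall>k\<ge>K. digit y k = 1)"
  shows "lam y < lam x"
proof -
  have split: "lam z = infsum (digit_weight z) {..<N} + (digit_weight z N + infsum (digit_weight z) {N+1..})" for z
  proof -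
    have "infsum (digit_weight z) UNIV = infsum (digit_weight z) ({..<N} \<union> ({N} \<union> {N+1..}))"
      by (rule arg_cong[where f = "infsum _"]) auto
    also have "\<dots> = infsum (digit_weight z) {..<N} + infsum (digit_weight z) ({N} \<union> {N+1..})"
      by (intro infsum_Un_disjoint summable_digit_weight) auto
    also have "infsum (digit_weight z) ({N} \<union> {N+1..}) = infsum (digit_weight z) {N} + infsum (digit_weight z) {N+1..}"
      by (intro infsum_Un_disjoint summable_digit_weight) auto
    finally show ?thesis by (simp add: lam_def)
  qed
  obtain j0 where j0: "j0 \<ge> N + 1" "digit y j0 = 0" using y digit_0_or_1 by metis
  have "infsum (digit_weight y) {N+1..} < 2 powi (- (N + 1))"
  proof (rule has_sum_strict_mono[OF has_sum_infsum[OF summable_digit_weight] has_sum_powi_tail])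
    show "digit_weight y j \<le> 2 powi (- j - 1)" for j using digit_0_or_1[of y j] by auto
    show "j0 \<in> {N+1..}" "digit_weight y j0 < 2 powi (- j0 - 1)" using j0 by auto
  qed
  moreover have "infsum (digit_weight x) {N+1..} \<ge> 0" by (intro infsum_nonneg) auto
  moreover have "infsum (digit_weight y) {..<N} = infsum (digit_weight x) {..<N}"
    by (intro infsum_cong) (use eq in auto)
  ultimately show ?thesis unfolding split using N by simp
qed

lemma inj_on_lam: "inj_on lam {x. \<not> (\<exists>K. \<forall>k\<ge>K. digit x k = 1)}"
proof (rule inj_onI, rule ccontr)
  fix x y assume x: "x \<in> {x. \<not> (\<exists>K. \<forall>k\<ge>K. digit x k = 1)}" and y: "y \<in> {x. \<not> (\<exists>K. \<forall>k\<ge>K. digit x k = 1)}"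
    and lam: "lam x = lam y" and "x \<noteq> y"
  then have nz: "x + y \<noteq> 0" by (metis cantor_add_self add_left_cancel)
  define N where "N = lead_index (x + y)"
  have below: "digit x j = digit y j" if "j < N" for j
    using lead_index(2)[OF nz, of j] that unfolding N_def by (simp only: digit_sum_eq_0_iff)
  have "digit x N \<noteq> digit y N"
    using lead_index(1)[OF nz] digit_sum_eq_0_iff[of x y N] unfolding N_def by simp
  then consider "digit x N = 1" "digit y N = 0" | "digit x N = 0" "digit y N = 1"
    using digit_0_or_1[of x N] digit_0_or_1[of y N] by auto
  then show False
    using lam_strict_mono[of N x y] lam_strict_mono[of N y x] below x y lam by cases auto
qed

text \<open>Finite support excludes a tail of ones, so x lies in the set on which \<open>lam\<close>
  is inverted, and it turns the infinite sum into a finite one.\<close>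

lemma lam_inv_eqI:
  assumes "finite {j. digit x j \<noteq> 0}" "(\<Sum>j | digit x j \<noteq> 0. 2 powi (- j - 1)) = h"
  shows "lam_inv h = x"
proof -
  have "\<not> (\<forall>k\<ge>K. digit x k = 1)" for K
  proof
    assume "\<forall>k\<ge>K. digit x k = 1"
    then have "{K..} \<subseteq> {j. digit x j \<noteq> 0}" by auto
    then show False using assms(1) finite_subset infinite_Ici by blast
  qed
  moreover have "lam x = h"
  proof -
    have "lam x = infsum (digit_weight x) {j. digit x j \<noteq> 0}"
      unfolding lam_def by (rule infsum_cong_neutral) auto
    also have "\<dots> = (\<Sum>j | digit x j \<noteq> 0. 2 powi (- j - 1))"
      using assms(1) by (subst infsum_finite) (auto intro!: sum.cong dest: digit_eq_1)
    finally show ?thesis using assms(2) by simp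
  qed
  ultimately show ?thesis
    unfolding lam_inv_def by (intro the_inv_into_f_eq inj_on_lam) auto
qed

definition unit_digit :: "int \<Rightarrow> cantor" where
  "unit_digit j = Abs_cantor (\<lambda>k. of_bool (k = j))"

lemma digit_unit_digit: "digit (unit_digit j) k = of_bool (k = j)"
  unfolding unit_digit_def by (subst Abs_cantor_inverse) (auto intro!: exI[of _ j])

lemma lam_inv_powi: "lam_inv (2 powi (- j - 1)) = unit_digit j"
  by (rule lam_inv_eqI) (simp_all add: digit_unit_digit)

text \<open>Bit i of n has weight \<open>2 ^ i\<close>, the weight of digit \<open>- i - 1\<close>,
  so the bits of n appear mirrored at the negative places.\<close>

definition bit_element :: "nat \<Rightarrow> cantor" where
  "bit_element n = Abs_cantor (\<lambda>k. of_bool (k < 0 \<and> bit n (nat (- k - 1))))"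

lemma not_bit_ge: "n < 2 ^ N \<Longrightarrow> N \<le> i \<Longrightarrow> \<not> bit (n::nat) i"
  by (metis bit_take_bit_iff not_less take_bit_nat_eq_self)

lemma digit_bit_element: "digit (bit_element n) k = of_bool (k < 0 \<and> bit n (nat (- k - 1)))"
proof -
  have "\<not> bit n (nat (- k - 1))" if "k < - int n - 1" for k
    by (rule not_bit_ge[of _ n]) (use that less_exp[of n] in auto)
  then show ?thesis
    unfolding bit_element_def
    by (subst Abs_cantor_inverse) (auto intro!: exI[of _ "- int n - 1"])
qed

lemma sum_bits_nat: "(\<Sum>i<n. of_bool (bit n i) * 2 ^ i) = (n::nat)"
proof -
  have "(\<Sum>i<n. of_bool (bit n i) * 2 ^ i) = take_bit n n"
    by (simp add: take_bit_sum push_bit_eq_mult lessThan_atLeast0)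
  then show ?thesis by (simp add: take_bit_nat_eq_self)
qed

lemma lam_inv_of_nat: "lam_inv (real n) = bit_element n"
proof -
  have *: "{j. digit (bit_element n) j \<noteq> 0} = (\<lambda>i. - int i - 1) ` {i. bit n i}"
    (is "_ = ?f ` _")
    by (auto simp: digit_bit_element image_iff intro!: exI[of _ "nat (- _ - 1)"])
  have sub: "{i. bit n i} \<subseteq> {..<n}" using not_bit_ge[of n n] less_exp[of n] by (auto simp: not_less[symmetric])
  then have fin: "finite {i. bit n i}" using finite_subset by blast
  have "(\<Sum>j | digit (bit_element n) j \<noteq> 0. 2 powi (- j - 1)) = (\<Sum>i | bit n i. (2::real) ^ i)"
    unfolding * by (subst sum.reindex) (auto simp: inj_on_def)
  also have "\<dots> = (\<Sum>i<n. of_bool (bit n i) * (2::real) ^ i)"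
    using sub by (intro sum.mono_neutral_cong_left) auto
  also have "\<dots> = real (\<Sum>i<n. of_bool (bit n i) * 2 ^ i)" by simp
  also have "(\<Sum>i<n. of_bool (bit n i) * 2 ^ i) = n" by (rule sum_bits_nat)
  finally show ?thesis using * fin by (intro lam_inv_eqI) auto
qed

section \<open>Walsh functions as characters\<close>

text \<open>The Rademacher functions, whose products are the Walsh functions.\<close>

definition walsh_sign :: "nat \<Rightarrow> cantor \<Rightarrow> complex" where
  "walsh_sign j x = (if digit x (int j) = 0 then 1 else -1)"

text \<open>Bit i of n sits at place \<open>- i - 1\<close> and is paired there with digit
  \<open>- (- i - 1) - 1 = i\<close> of x. Any sufficiently large N is allowed, so the index range
  can be adapted to each use.\<close>

lemma walsh_eq_prod: "n < 2 ^ N \<Longrightarrow> walsh n x = (\<Prod>i<N. if bit n i then walsh_sign i x else 1)"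
proof -
  assume n: "n < 2 ^ N"
  let ?A = "{i. i < N \<and> bit n i}"
  let ?g = "\<lambda>k. digit (bit_element n) k * digit x (- k - 1)"
  have *: "{k. ?g k \<noteq> 0} = (\<lambda>i. - int i - 1) ` {i\<in>?A. digit x (int i) \<noteq> 0}"
  proof (intro equalityI subsetI)
    fix k assume "k \<in> {k. ?g k \<noteq> 0}"
    then have "k < 0" "bit n (nat (- k - 1))" "digit x (- k - 1) \<noteq> 0"
      by (auto simp: digit_bit_element split: if_splits)
    moreover then have "nat (- k - 1) < N" using not_bit_ge[OF n] not_less by blast
    ultimately show "k \<in> (\<lambda>i. - int i - 1) ` {i\<in>?A. digit x (int i) \<noteq> 0}"
      by (intro image_eqI[of _ _ "nat (- k - 1)"]) auto
  qed (auto simp: digit_bit_element)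
  have "(\<Sum>k | ?g k \<noteq> 0. ?g k) = (\<Sum>i\<in>{i\<in>?A. digit x (int i) \<noteq> 0}. ?g (- int i - 1))"
    unfolding * by (subst sum.reindex) (auto simp: inj_on_def)
  also have "\<dots> = (\<Sum>i\<in>?A. digit x (int i))"
    by (intro sum.mono_neutral_cong_left) (auto simp: digit_bit_element)
  finally have "walsh n x = (-1) ^ (\<Sum>i\<in>?A. digit x (int i))"
    by (simp add: walsh_def lam_inv_of_nat Let_def)
  also have "\<dots> = (\<Prod>i\<in>?A. walsh_sign i x)"
    unfolding power_sum walsh_sign_def by (intro prod.cong) (auto dest: digit_eq_1)
  also have "\<dots> = (\<Prod>i<N. if bit n i then walsh_sign i x else 1)"
    by (intro prod.mono_neutral_cong_left) auto
  finally show ?thesis .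
qed

lemma walsh_0 [simp]: "walsh 0 x = 1"
  using walsh_eq_prod[of 0 0] by simp

lemma walsh_sign_add: "walsh_sign i (x + y) = walsh_sign i x * walsh_sign i y"
  using digit_0_or_1[of x "int i"] digit_0_or_1[of y "int i"] by (auto simp: walsh_sign_def)

lemma walsh_add: "walsh n (x + y) = walsh n x * walsh n y"
proof -
  have "walsh n (x + y) = (\<Prod>i<n. (if bit n i then walsh_sign i x else 1) * (if bit n i then walsh_sign i y else 1))"
    unfolding walsh_eq_prod[OF less_exp[of n]] by (intro prod.cong) (auto simp: walsh_sign_add)
  also have "\<dots> = walsh n x * walsh n y"
    unfolding walsh_eq_prod[OF less_exp[of n]] by (rule prod.distrib)
  finally show ?thesis .
qed

lemma walsh_cases: "walsh n x = 1 \<or> walsh n x = - 1"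
proof -
  have "walsh n x * walsh n x = walsh n 0" by (simp flip: walsh_add)
  also have "\<dots> = 1" unfolding walsh_eq_prod[OF less_exp[of n]] by (intro prod.neutral) (simp add: walsh_sign_def)
  finally show ?thesis by (simp add: square_eq_1_iff)
qed

lemma walsh_mult_self: "walsh n x * walsh n x = 1"
  using walsh_cases[of n x] by auto

lemma norm_walsh [simp]: "norm (walsh n x) = 1"
  using walsh_cases[of n x] by auto

lemma cnj_walsh [simp]: "cnj (walsh n x) = walsh n x"
  using walsh_cases[of n x] by auto

text \<open>By multiplicativity this is the factor by which flipping digit j changes
  \<open>walsh n\<close>; the Gibbs eigenvalues and orthogonality both come from it.\<close>

lemma walsh_unit_digit: "walsh n (unit_digit j) = (if j \<ge> 0 \<and> bit n (nat j) then -1 else 1)"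
proof (cases "j \<ge> 0 \<and> bit n (nat j)")
  case True
  then have "nat j < n" using not_bit_ge[of n n] less_exp[of n] not_less by blast
  then have "(\<Prod>i<n. if bit n i then walsh_sign i (unit_digit j) else 1) = (\<Prod>i\<in>{nat j}. -1)"
    using True by (intro prod.mono_neutral_cong_right) (auto simp: walsh_sign_def digit_unit_digit)
  then show ?thesis using True unfolding walsh_eq_prod[OF less_exp[of n]] by simp
next
  case False
  then show ?thesis
    unfolding walsh_eq_prod[OF less_exp[of n]] by (subst prod.neutral) (auto simp: walsh_sign_def digit_unit_digit)
qed

section \<open>Functions of finitely many non-negative digits\<close>

text \<open>Ignoring negative digits builds in 1-periodicity, and ignoring those from N on builds in
  constancy on cylinders of level N: the test function condition with a uniform level.\<close>

definition depends_on :: "nat \<Rightarrow> (cantor \<Rightarrow> 'a) \<Rightarrow> bool" where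
  "depends_on N f \<longleftrightarrow> (\<forall>x y. (\<forall>k. 0 \<le> k \<and> k < int N \<longrightarrow> digit x k = digit y k) \<longrightarrow> f x = f y)"

lemma depends_on_walsh: "n < 2 ^ N \<Longrightarrow> depends_on N (walsh n)"
  unfolding depends_on_def by (auto simp: walsh_eq_prod walsh_sign_def intro!: prod.cong)

text \<open>The difference of x and y has only negative digits, hence is \<open>lam_inv\<close> of
  the natural number with these digits, mirrored, as bits. So y is an integer translate of
  x.\<close>

lemma periodic1_eq:
  assumes "periodic1 f" "\<And>k. k \<ge> 0 \<Longrightarrow> digit x k = digit y k"
  shows "f x = f y"
proof -
  obtain K where K: "\<forall>k<K. digit (x + y) k = 0" using digit_bounded by blast
  define M where "M = nat (- K)"
  define n :: nat where "n = horner_sum of_bool 2 (map (\<lambda>i. digit (x + y) (- int i - 1) = 1) [0..<M])"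
  have bit: "bit n i \<longleftrightarrow> i < M \<and> digit (x + y) (- int i - 1) = 1" for i
    unfolding n_def by (auto simp: bit_horner_sum_bit_iff simp del: digit_plus)
  have "lam_inv (real n) = x + y"
  proof (rule cantor_eqI)
    fix k
    have "digit (x + y) k = 0" if "k \<ge> 0" using assms(2)[OF that] digit_sum_eq_0_iff by blast
    then show "digit (lam_inv (real n)) k = digit (x + y) k"
      using K digit_0_or_1[of "x + y" k] by (auto simp: lam_inv_of_nat digit_bit_element bit M_def simp del: digit_plus)
  qed
  then have "f (x + (x + y)) = f x" using assms(1) unfolding periodic1_def by metis
  then show ?thesis by (simp flip: add.assoc)
qed

lemma depends_on_imp_periodic1: "depends_on N f \<Longrightarrow> periodic1 f"
  unfolding periodic1_def lam_inv_of_nat depends_on_def by (auto simp: digit_bit_element)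

lemma depends_on_imp_test_P: "depends_on N f \<Longrightarrow> f \<in> test_P"
proof -
  assume f: "depends_on N f"
  have "\<exists>U. open U \<and> x \<in> U \<and> f constant_on U" for x
  proof (intro exI[of _ "cyl x (int N)"] conjI open_cyl)
    show "x \<in> cyl x (int N)" by (simp add: cyl_def)
    have "f y = f x" if "y \<in> cyl x (int N)" for y
      using f that unfolding depends_on_def cyl_def by blast
    then show "f constant_on cyl x (int N)" unfolding constant_on_def by blast
  qed
  then show ?thesis using depends_on_imp_periodic1[OF f] by (simp add: test_P_def)
qed

text \<open>The bits of \<open>2 ^ N\<close> and k are disjoint, so the addition has no carry and
  contributes just one Rademacher factor.\<close>

lemma walsh_add_power:
  assumes "k < 2 ^ N"
  shows "walsh (2 ^ N + k) x = walsh_sign N x * walsh k x"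
proof -
  have "bit (2 ^ N + k) i \<longleftrightarrow> i = N \<or> bit k i" for i
  proof -
    have "2 ^ N + k = or (2 ^ N) k"
      by (rule disjunctive_add) (use not_bit_ge[OF assms, of N] in \<open>auto simp: bit_exp_iff\<close>)
    then show ?thesis by (auto simp: bit_or_iff bit_exp_iff)
  qed
  then have b: "bit (2 ^ N + k) N" "\<And>i. i < N \<Longrightarrow> bit (2 ^ N + k) i = bit k i" by auto
  have "walsh (2 ^ N + k) x = (\<Prod>i<Suc N. if bit (2 ^ N + k) i then walsh_sign i x else 1)"
    using assms by (intro walsh_eq_prod) simp
  then show ?thesis using b by (simp add: walsh_eq_prod[OF assms])
qed

text \<open>Induction on the number of digits: f splits into parts even and odd under flipping digit
  N, as \<open>f0 + walsh_sign N * f1\<close>, where neither \<open>f0\<close> nor \<open>f1\<close>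
  sees digit N. The odd part supplies the indices from \<open>2 ^ N\<close> on.\<close>

lemma depends_on_imp_walsh_sum:
  "depends_on N f \<Longrightarrow> \<exists>c. f = (\<lambda>x. \<Sum>k<2^N. c k * walsh k x)"
proof (induction N arbitrary: f)
  case 0
  then show ?case by (intro exI[of _ "\<lambda>_. f 0"]) (auto simp: depends_on_def)
next
  case (Suc N)
  define z where "z x = x + (if digit x (int N) = 1 then unit_digit (int N) else 0)" for x
  have z: "digit (z x) k = (if k = int N then 0 else digit x k)" for x k
    using digit_0_or_1[of x k] by (auto simp: z_def digit_unit_digit)
  have z': "digit (z x + unit_digit (int N)) k = (if k = int N then 1 else digit x k)" for x k
    using digit_0_or_1[of x k] by (simp add: z digit_unit_digit)
  have dep: "f x = f y" if "\<And>k. 0 \<le> k \<Longrightarrow> k \<le> int N \<Longrightarrow> digit x k = digit y k" for x y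
    using Suc.prems that unfolding depends_on_def by force
  define f0 where "f0 x = (f (z x) + f (z x + unit_digit (int N))) / 2" for x
  define f1 where "f1 x = (f (z x) - f (z x + unit_digit (int N))) / 2" for x
  have dd: "depends_on N (\<lambda>x. f (z x))" "depends_on N (\<lambda>x. f (z x + unit_digit (int N)))"
    unfolding depends_on_def by (auto intro!: dep simp: z z' simp del: digit_plus)
  have "depends_on N f0" "depends_on N f1"
    using dd unfolding depends_on_def f0_def f1_def by metis+
  then obtain c0 c1 where c: "f0 = (\<lambda>x. \<Sum>k<2^N. c0 k * walsh k x)" "f1 = (\<lambda>x. \<Sum>k<2^N. c1 k * walsh k x)"
    using Suc.IH by metis
  define c where "c k = (if k < 2^N then c0 k else c1 (k - 2^N))" for k
  have "f x = (\<Sum>k<2^Suc N. c k * walsh k x)" for x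
  proof -
    have "f x = f0 x + walsh_sign N x * f1 x"
    proof (cases "digit x (int N) = 0")
      case True
      then have "f x = f (z x)" by (intro dep) (auto simp: z)
      then show ?thesis using True by (simp add: f0_def f1_def walsh_sign_def field_simps)
    next
      case False
      then have "digit x (int N) = 1" using digit_0_or_1[of x "int N"] by auto
      then have "f x = f (z x + unit_digit (int N))" by (intro dep) (auto simp: z' simp del: digit_plus)
      then show ?thesis using False by (simp add: f0_def f1_def walsh_sign_def field_simps)
    qed
    also have "f0 x = (\<Sum>k<2^N. c k * walsh k x)" unfolding c by (simp add: c_def)
    also have "walsh_sign N x * f1 x = (\<Sum>k<2^N. c (2^N + k) * walsh (2^N + k) x)"
      unfolding c by (simp add: c_def walsh_add_power sum_distrib_left mult_ac)
    also have "\<dots> = (\<Sum>k=2^N..<2^Suc N. c k * walsh k x)"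
      by (rule sum.reindex_bij_witness[of _ "\<lambda>k. k - 2^N" "\<lambda>k. 2^N + k"]) auto
    also have "(\<Sum>k<2^N. c k * walsh k x) + \<dots> = (\<Sum>k<2^Suc N. c k * walsh k x)"
      unfolding lessThan_atLeast0 by (intro sum.atLeastLessThan_concat) auto
    finally show ?thesis .
  qed
  then show ?case by blast
qed

text \<open>The hybrid \<open>y'\<close> takes its negative digits from x and the others from y:
  periodicity gives y and \<open>y'\<close> the same value, local constancy does so for
  \<open>y'\<close> and x.\<close>

lemma depends_onI:
  assumes "periodic1 f" and "\<And>x. f constant_on cyl x (int N)"
  shows "depends_on N f"
  unfolding depends_on_def
proof (intro allI impI)
  fix x y assume xy: "\<forall>k. 0 \<le> k \<and> k < int N \<longrightarrow> digit x k = digit y k"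
  define y' where "y' = Abs_cantor (\<lambda>k. if k < 0 then digit x k else digit y k)"
  have y': "digit y' k = (if k < 0 then digit x k else digit y k)" for k
    unfolding y'_def using digit_0_or_1[of x] digit_0_or_1[of y] digit_bounded[of x]
    by (subst Abs_cantor_inverse) (force intro: exI[of _ "min 0 _"])+
  have "f y = f y'" by (rule periodic1_eq[OF assms(1)]) (simp add: y')
  also have "\<dots> = f x"
  proof -
    have "x \<in> cyl x (int N)" "y' \<in> cyl x (int N)" using xy by (auto simp: cyl_def y')
    then show ?thesis using assms(2)[of x] unfolding constant_on_def by metis
  qed
  finally show "f x = f y" by simp
qed

text \<open>Koenig's lemma on the tree of cylinders inside the unit ball replaces compactness.\<close>

lemma test_P_depends_on:
  assumes "f \<in> test_P"
  shows "\<exists>N. depends_on N f"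
proof (rule ccontr)
  assume none: "\<not> (\<exists>N. depends_on N f)"
  have per: "periodic1 f" and loc: "\<And>x. \<exists>U. open U \<and> x \<in> U \<and> f constant_on U"
    using assms by (auto simp: test_P_def)
  \<comment> \<open>A cylinder is bad if no single level makes f constant around all of its
    points.\<close>
  define bad where "bad x n \<longleftrightarrow> (\<forall>N::nat. \<exists>y\<in>cyl x (int n). \<not> f constant_on cyl y (int N))" for x n
  have mono: "f constant_on cyl y (int N)" if "f constant_on cyl y (int M)" "M \<le> N" for y M N
    using that(1) by (rule constant_on_subset) (use that(2) in \<open>auto simp: cyl_def\<close>)
  have step: "bad x (Suc n) \<or> bad (x + unit_digit (int n)) (Suc n)" if bad: "bad x n" for x n
  proof (rule ccontr)
    assume "\<not> ?thesis"
    then obtain M1 M2 where M: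
      "\<And>y. y \<in> cyl x (int (Suc n)) \<Longrightarrow> f constant_on cyl y (int M1)"
      "\<And>y. y \<in> cyl (x + unit_digit (int n)) (int (Suc n)) \<Longrightarrow> f constant_on cyl y (int M2)"
      unfolding bad_def by blast
    have "f constant_on cyl y (int (max M1 M2))" if "y \<in> cyl x (int n)" for y
    proof (cases "digit y (int n) = digit x (int n)")
      case True
      then have "y \<in> cyl x (int (Suc n))" using that by (simp add: cyl_Suc del: of_nat_Suc)
      then show ?thesis using M(1) mono by (meson max.cobounded1)
    next
      case False
      then have "digit y (int n) = digit (x + unit_digit (int n)) (int n)"
        using digit_0_or_1[of y "int n"] digit_0_or_1[of x "int n"] by (auto simp: digit_unit_digit)
      then have "y \<in> cyl (x + unit_digit (int n)) (int (Suc n))"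
        using that by (auto simp: cyl_Suc cyl_def[of _ "int n"] digit_unit_digit simp del: of_nat_Suc)
      then show ?thesis using M(2) mono by (meson max.cobounded2)
    qed
    then show False using bad unfolding bad_def by blast
  qed
  have "\<exists>s. s 0 = 0 \<and> (\<forall>n. bad (s n) n) \<and> (\<forall>n. s (Suc n) = s n \<or> s (Suc n) = s n + unit_digit (int n))"
  proof -
    define s where "s = rec_nat (0::cantor) (\<lambda>n x. if bad x (Suc n) then x else x + unit_digit (int n))"
    have s: "s 0 = 0" "s (Suc n) = (if bad (s n) (Suc n) then s n else s n + unit_digit (int n))" for n
      by (simp_all add: s_def)
    have "bad (s n) n" for n
    proof (induction n)
      case 0
      \<comment> \<open>The root is the unit ball. A level uniform there would be uniform
        everywhere, since clearing negative digits does not change the value of a periodic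
        function.\<close>
      have "\<exists>y\<in>cyl 0 0. \<not> f constant_on cyl y (int N)" for N
      proof (rule ccontr)
        assume c: "\<not> ?thesis"
        have "f constant_on cyl x (int N)" for x
        proof -
          define x' where "x' = Abs_cantor (\<lambda>k. if k < 0 then 0 else digit x k)"
          have x': "digit x' k = (if k < 0 then 0 else digit x k)" for k
            unfolding x'_def using digit_0_or_1[of x] by (subst Abs_cantor_inverse) auto
          then have "x' \<in> cyl 0 0" by (simp add: cyl_def)
          then obtain v where v: "\<And>y. y \<in> cyl x' (int N) \<Longrightarrow> f y = v"
            using c unfolding constant_on_def by blast
          have "f y = v" if "y \<in> cyl x (int N)" for y
          proof -
            define y' where "y' = Abs_cantor (\<lambda>k. if k < 0 then 0 else digit y k)"
            have y': "digit y' k = (if k < 0 then 0 else digit y k)" for k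
              unfolding y'_def using digit_0_or_1[of y] by (subst Abs_cantor_inverse) auto
            have "f y = f y'" by (rule periodic1_eq[OF per]) (simp add: y')
            also have "f y' = v" by (rule v) (use that in \<open>auto simp: cyl_def y' x'\<close>)
            finally show ?thesis .
          qed
          then show ?thesis unfolding constant_on_def by blast
        qed
        then show False using none depends_onI[OF per] by blast
      qed
      then show ?case by (simp add: bad_def s)
    next
      case (Suc n)
      then show ?case using step[OF Suc] by (auto simp: s)
    qed
    then show ?thesis using s by (metis (full_types))
  qed
  then obtain s where s: "s 0 = 0" "\<And>n. bad (s n) n"
    "\<And>n. s (Suc n) = s n \<or> s (Suc n) = s n + unit_digit (int n)" by blast
  have stab1: "digit (s (Suc n)) k = digit (s n) k" if "k \<noteq> int n" for n k
    using s(3)[of n] that by (auto simp: digit_unit_digit)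
  have stab: "digit (s n) k = digit (s m) k" if "m \<le> n" "k < int m" for m n k
    using that(1) by (induction rule: dec_induct) (use that(2) stab1 in auto)
  have neg: "digit (s n) k = 0" if "k < 0" for n k
    by (induction n) (use s(1) stab1 that in auto)
  \<comment> \<open>Digit k no longer changes from stage \<open>Suc k\<close> on, so reading it
    there yields the limit of the branch.\<close>
  define x where "x = Abs_cantor (\<lambda>k. if k < 0 then 0 else digit (s (Suc (nat k))) k)"
  have x: "digit x k = (if k < 0 then 0 else digit (s (Suc (nat k))) k)" for k
    unfolding x_def using digit_0_or_1 by (subst Abs_cantor_inverse) auto
  have cyl: "cyl x (int n) = cyl (s n) (int n)" for n
  proof -
    have "digit x k = digit (s n) k" if "k < int n" for k
      using that stab[of "Suc (nat k)" n k] by (auto simp: x neg)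
    then show ?thesis by (auto simp: cyl_def)
  qed
  obtain U where U: "open U" "x \<in> U" "f constant_on U" using loc by blast
  have "x \<in> \<Union>{C \<in> range (\<lambda>(x, n). cyl x n). C \<subseteq> U}" using open_eq_Union_cyl[OF U(1)] U(2) by blast
  then obtain z n where zn: "x \<in> cyl z n" "cyl z n \<subseteq> U" by auto
  have "cyl x (int (nat n)) \<subseteq> cyl z n" using zn(1) by (auto simp: cyl_def)
  then have const: "f constant_on cyl x (int (nat n))" using U(3) zn(2) constant_on_subset by blast
  \<comment> \<open>Badness gives a point y of the cylinder around which f is not constant at the
    same level; but each point of a cylinder generates that same cylinder.\<close>
  obtain y where y: "y \<in> cyl x (int (nat n))" "\<not> f constant_on cyl y (int (nat n))"
    using s(2)[of "nat n"] unfolding bad_def cyl by blast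
  have "cyl y (int (nat n)) = cyl x (int (nat n))" using y(1) by (auto simp: cyl_def)
  then show False using y const by simp
qed

section \<open>Gibbs derivative and distributions\<close>

lemma shift_powi: "shift (2 powi (- j - 1)) f x = f (x + unit_digit j)"
  by (simp add: shift_def lam_inv_powi)

text \<open>Term j is \<open>2 powi j * walsh m x\<close> if j is non-negative and bit j of m is
  set, and 0 otherwise, since Walsh functions ignore negative digits. From \<open>n = m\<close> on,
  the partial sums are the binary expansion of m times \<open>walsh m x\<close>.\<close>

lemma tendsto_gibbs_walsh:
  "(\<lambda>n. \<Sum>j = - int n..int n. 2 powi (j - 1) * (walsh m x - shift (2 powi (- j - 1)) (walsh m) x))
     \<longlonglongrightarrow> of_nat m * walsh m x"
proof (rule tendsto_eventually)
  have "(\<Sum>j = - int n..int n. 2 powi (j - 1) * (walsh m x - shift (2 powi (- j - 1)) (walsh m) x))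
      = of_nat m * walsh m x" if "n \<ge> m" for n
  proof -
    have "(\<Sum>j = - int n..int n. 2 powi (j - 1) * (walsh m x - shift (2 powi (- j - 1)) (walsh m) x))
        = (\<Sum>j\<in>int ` {..<m}. of_bool (bit m (nat j)) * 2 powi j * walsh m x)"
    proof (intro sum.mono_neutral_cong_right ballI)
      fix j assume j: "j \<in> {- int n..int n} - int ` {..<m}"
      then have "j < 0 \<or> \<not> nat j < m" by (metis DiffE imageI int_nat_eq lessThan_iff not_le)
      then have "\<not> (j \<ge> 0 \<and> bit m (nat j))" using not_bit_ge[OF less_exp[of m]] by auto
      then show "2 powi (j - 1) * (walsh m x - shift (2 powi (- j - 1)) (walsh m) x) = 0"
        unfolding shift_powi walsh_add walsh_unit_digit by (simp only: if_False) simp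
    next
      fix j assume "j \<in> int ` {..<m}"
      moreover have "(2::complex) powi j = 2 powi (j - 1) * 2"
        using power_int_add_1[of "2::complex" "j - 1"] by simp
      ultimately show "2 powi (j - 1) * (walsh m x - shift (2 powi (- j - 1)) (walsh m) x) =
          of_bool (bit m (nat j)) * 2 powi j * walsh m x"
        by (auto simp: shift_powi walsh_add walsh_unit_digit)
    qed (use that in auto)
    also have "\<dots> = (\<Sum>i<m. of_bool (bit m i) * 2 ^ i * walsh m x)"
      by (subst sum.reindex) (simp_all del: sum_mult_of_bool_eq sum_of_bool_mult_eq)
    also have "\<dots> = of_nat (\<Sum>i<m. of_bool (bit m i) * 2 ^ i) * walsh m x"
      unfolding of_nat_sum sum_distrib_right by (intro sum.cong) simp_all
    finally show ?thesis by (simp only: sum_bits_nat)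
  qed
  then show "\<forall>\<^sub>F n in sequentially. (\<Sum>j = - int n..int n. 2 powi (j - 1) *
      (walsh m x - shift (2 powi (- j - 1)) (walsh m) x)) = of_nat m * walsh m x"
    unfolding eventually_sequentially by blast
qed

text \<open>\<open>lim\<close> respects sums only for convergent sequences, so the convergence of
  every summand is carried along, not just its limit value.\<close>

lemma gibbs_walsh_sum:
  "gibbs (\<lambda>x. \<Sum>k<K. c k * walsh k x) = (\<lambda>x. \<Sum>k<K. (of_nat k * c k) * walsh k x)"
proof
  fix x
  have "(\<lambda>n. \<Sum>k<K. c k * (\<Sum>j = - int n..int n. 2 powi (j - 1) *
        (walsh k x - shift (2 powi (- j - 1)) (walsh k) x))) \<longlonglongrightarrow> (\<Sum>k<K. c k * (of_nat k * walsh k x))"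
    by (intro tendsto_sum tendsto_mult_left tendsto_gibbs_walsh)
  also have "(\<lambda>n. \<Sum>k<K. c k * (\<Sum>j = - int n..int n. 2 powi (j - 1) *
        (walsh k x - shift (2 powi (- j - 1)) (walsh k) x))) =
      (\<lambda>n. \<Sum>j = - int n..int n. 2 powi (j - 1) * ((\<Sum>k<K. c k * walsh k x) -
        shift (2 powi (- j - 1)) (\<lambda>x. \<Sum>k<K. c k * walsh k x) x))"
    unfolding sum_distrib_left
    by (rule ext, subst sum.swap)
      (simp add: shift_def sum_subtractf sum_distrib_left algebra_simps)
  finally show "gibbs (\<lambda>x. \<Sum>k<K. c k * walsh k x) x = (\<Sum>k<K. (of_nat k * c k) * walsh k x)"
    unfolding gibbs_def by (subst limI) (auto simp: mult_ac)
qed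

lemma gibbs_power_walsh_sum:
  "(gibbs ^^ n) (\<lambda>x. \<Sum>k<K. c k * walsh k x) = (\<lambda>x. \<Sum>k<K. (of_nat k ^ n * c k) * walsh k x)"
  by (induction n) (simp_all add: gibbs_walsh_sum mult.assoc[symmetric])

lemma depends_on_walsh_sum: "depends_on K (\<lambda>x. \<Sum>k<K. c k * walsh k x)"
  unfolding depends_on_def
proof (intro allI impI sum.cong refl)
  fix x y k
  assume xy: "\<forall>k. 0 \<le> k \<and> k < int K \<longrightarrow> digit x k = digit y k" and "k \<in> {..<K}"
  then have "depends_on K (walsh k)" by (intro depends_on_walsh) (use less_exp[of K] in \<open>auto intro: less_trans\<close>)
  then show "c k * walsh k x = c k * walsh k y" using xy unfolding depends_on_def by metis
qed

lemma test_P_walsh_sum: "(\<lambda>x. \<Sum>k<K. c k * walsh k x) \<in> test_P"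
  using depends_on_walsh_sum by (rule depends_on_imp_test_P)

lemma test_P_iff: "\<phi> \<in> test_P \<longleftrightarrow> (\<exists>K c. \<phi> = (\<lambda>x. \<Sum>k<K. c k * walsh k x))"
proof
  assume "\<phi> \<in> test_P"
  then obtain N where "depends_on N \<phi>" using test_P_depends_on by blast
  then obtain c where "\<phi> = (\<lambda>x. \<Sum>k<2^N. c k * walsh k x)" using depends_on_imp_walsh_sum by blast
  then show "\<exists>K c. \<phi> = (\<lambda>x. \<Sum>k<K. c k * walsh k x)" by blast
qed (auto simp: test_P_walsh_sum)

lemma walsh_eq_sum: "walsh m = (\<lambda>x. \<Sum>k<Suc m. of_bool (k = m) * walsh k x)"
  by (rule ext) simp

lemma walsh_in_test_P: "walsh m \<in> test_P"
  by (subst walsh_eq_sum) (rule test_P_walsh_sum)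

section \<open>Functionals on Walsh polynomials and the decoupled equation\<close>

lemma dist_P_add:
  "F \<in> dist_P \<Longrightarrow> \<phi> \<in> test_P \<Longrightarrow> \<psi> \<in> test_P \<Longrightarrow> F (\<lambda>x. \<phi> x + \<psi> x) = F \<phi> + F \<psi>"
  by (simp add: dist_P_def)

lemma dist_P_walsh_sum:
  assumes "F \<in> dist_P"
  shows "F (\<lambda>x. \<Sum>k<K. c k * walsh k x) = (\<Sum>k<K. c k * F (walsh k))"
proof (induction K)
  case 0
  \<comment> \<open>The empty sum is the zero function, which homogeneity with factor 0 sends to
    0.\<close>
  have "F (\<lambda>x. 0 * walsh 0 x) = 0 * F (walsh 0)"
    using assms walsh_in_test_P unfolding dist_P_def by blast
  then show ?case by simp
next
  case (Suc K)
  have smult: "F (\<lambda>x. c K * walsh K x) = c K * F (walsh K)"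
    using assms walsh_in_test_P unfolding dist_P_def by blast
  have "(\<lambda>x. c K * walsh K x) = (\<lambda>x. \<Sum>k<Suc K. (c k * of_bool (k = K)) * walsh k x)"
    by (rule ext) simp
  then have "(\<lambda>x. c K * walsh K x) \<in> test_P" using test_P_walsh_sum by metis
  then have "F (\<lambda>x. (\<Sum>k<K. c k * walsh k x) + c K * walsh K x) =
      F (\<lambda>x. \<Sum>k<K. c k * walsh k x) + F (\<lambda>x. c K * walsh K x)"
    using assms test_P_walsh_sum by (intro dist_P_add)
  then show ?case using Suc smult by simp
qed

text \<open>G is asked only to be extensional, so it may be the left-hand side of the equation or
  \<open>regular_dist u\<close>; continuity of these then follows from the equality with F.\<close>

lemma dist_P_eqI:
  assumes F: "F \<in> dist_P" and G: "G \<in> extensional test_P"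
    and eq: "\<And>K c. G (\<lambda>x. \<Sum>k<K. c k * walsh k x) = (\<Sum>k<K. c k * F (walsh k))"
  shows "F = G"
proof (rule extensionalityI[of _ test_P])
  show "F \<in> extensional test_P" using F by (simp add: dist_P_def)
  show "F \<phi> = G \<phi>" if "\<phi> \<in> test_P" for \<phi>
    using that dist_P_walsh_sum[OF F] eq unfolding test_P_iff by auto
qed (rule G)

text \<open>Testing with \<open>walsh m\<close> gives the scalar equations. Conversely, by
  \<open>L\<close> they fix the left-hand side on every Walsh polynomial, and extensionality settles
  the rest.\<close>

lemma solutions_iff:
  assumes g: "has_walsh_rep g d"
  shows "F \<in> solutions n \<alpha> g \<longleftrightarrow>
    F \<in> dist_P \<and> (\<forall>m. poly (charpoly n \<alpha>) (of_nat m) * F (walsh m) = d m)"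
proof -
  let ?L = "\<lambda>\<phi>\<in>test_P. \<Sum>k\<le>n. \<alpha> k * gibbs_dist k F \<phi>"
  have g': "g \<in> dist_P" "\<And>k. g (walsh k) = d k" using g by (auto simp: has_walsh_rep_def)
  have L: "?L (\<lambda>x. \<Sum>m<K. c m * walsh m x) =
      (\<Sum>m<K. c m * (poly (charpoly n \<alpha>) (of_nat m) * F (walsh m)))" if F: "F \<in> dist_P" for K c
  proof -
    have "?L (\<lambda>x. \<Sum>m<K. c m * walsh m x) = (\<Sum>k\<le>n. \<alpha> k * (\<Sum>m<K. of_nat m ^ k * c m * F (walsh m)))"
      by (simp add: test_P_walsh_sum gibbs_dist_def gibbs_power_walsh_sum dist_P_walsh_sum[OF F])
    also have "\<dots> = (\<Sum>m<K. \<Sum>k\<le>n. \<alpha> k * (of_nat m ^ k * c m * F (walsh m)))"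
      unfolding sum_distrib_left by (rule sum.swap)
    also have "\<dots> = (\<Sum>m<K. c m * (poly (charpoly n \<alpha>) (of_nat m) * F (walsh m)))"
      by (simp add: charpoly_def poly_sum poly_monom sum_distrib_left sum_distrib_right mult_ac)
    finally show ?thesis .
  qed
  show ?thesis
  proof (cases "F \<in> dist_P")
    case F: True
    have "?L = g \<longleftrightarrow> (\<forall>m. poly (charpoly n \<alpha>) (of_nat m) * F (walsh m) = d m)"
    proof
      assume eq: "?L = g"
      show "\<forall>m. poly (charpoly n \<alpha>) (of_nat m) * F (walsh m) = d m"
      proof
        fix m
        have "d m = ?L (walsh m)" using eq g'(2) by metis
        also have "\<dots> = poly (charpoly n \<alpha>) (of_nat m) * F (walsh m)"
          unfolding arg_cong[OF walsh_eq_sum, of ?L m] L[OF F] by simp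
        finally show "poly (charpoly n \<alpha>) (of_nat m) * F (walsh m) = d m" by simp
      qed
    next
      assume "\<forall>m. poly (charpoly n \<alpha>) (of_nat m) * F (walsh m) = d m"
      then have "g = ?L" by (intro dist_P_eqI g'(1)) (use L[OF F] g'(2) in auto)
      then show "?L = g" by simp
    qed
    then show ?thesis using F by (simp add: solutions_def)
  qed (simp add: solutions_def)
qed

section \<open>Haar measure on the unit ball and orthonormality\<close>

definition haar_unit :: "cantor measure" where
  "haar_unit = restrict_space haar unit_ball"

lemma sets_haar [measurable_cong]: "sets haar = sets borel"
  using is_haar_haar by (simp add: is_haar_def)

lemma space_haar [simp]: "space haar = UNIV"
  using sets_eq_imp_space_eq[OF sets_haar] by simp

lemma unit_ball_in_sets [simp, measurable]: "unit_ball \<in> sets haar"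
  by (simp add: sets_haar unit_ball_eq_cyl)

lemma space_haar_unit: "space haar_unit = unit_ball"
  by (simp add: haar_unit_def space_restrict_space)

lemma emeasure_haar_unit: "emeasure haar_unit (space haar_unit) = 1"
  using is_haar_haar unfolding space_haar_unit haar_unit_def
  by (subst emeasure_restrict_space) (auto simp: is_haar_def)

lemma finite_measure_haar_unit: "finite_measure haar_unit"
  by standard (simp add: emeasure_haar_unit)

lemma measure_haar_unit [simp]: "measure haar_unit (space haar_unit) = 1"
  by (simp add: measure_def emeasure_haar_unit)

lemma borel_measurable_haar_unit: "f \<in> borel_measurable borel \<Longrightarrow> f \<in> borel_measurable haar_unit"
  unfolding haar_unit_def by (intro measurable_restrict_space1) (simp cong: measurable_cong_sets add: sets_haar)

lemma set_lebesgue_integral_unit_ball: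
  fixes f :: "cantor \<Rightarrow> 'a :: {banach, second_countable_topology}"
  shows "(LINT x:unit_ball|haar. f x) = integral\<^sup>L haar_unit f"
  unfolding set_lebesgue_integral_def haar_unit_def by (subst integral_restrict_space) simp_all

lemma integrable_haar_unitI:
  fixes f :: "cantor \<Rightarrow> 'a :: {banach, second_countable_topology}"
  assumes "f \<in> borel_measurable borel" "\<And>x. norm (f x) \<le> B"
  shows "integrable haar_unit f"
  by (rule finite_measure.integrable_const_bound[OF finite_measure_haar_unit, of _ B]) (use assms borel_measurable_haar_unit in auto)

lemma norm_integral_haar_unit_le:
  fixes f :: "cantor \<Rightarrow> 'a :: {banach, second_countable_topology}"
  assumes "B \<ge> 0" "\<And>x. x \<in> unit_ball \<Longrightarrow> norm (f x) \<le> B"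
  shows "norm (integral\<^sup>L haar_unit f) \<le> B"
proof (cases "integrable haar_unit f")
  case True
  have "norm (integral\<^sup>L haar_unit f) \<le> (\<integral>x. norm (f x) \<partial>haar_unit)" by (rule integral_norm_bound)
  also have "\<dots> \<le> (\<integral>x. B \<partial>haar_unit)"
    using True assms(2) by (intro integral_mono finite_measure.integrable_const[OF finite_measure_haar_unit]) (auto simp: space_haar_unit)
  finally show ?thesis by simp
\<comment> \<open>The integral of a non-integrable function is 0 by default, which
  \<open>B \<ge> 0\<close> covers.\<close>
qed (simp add: not_integrable_integral_eq assms)

lemma depends_on_imp_continuous:
  fixes f :: "cantor \<Rightarrow> 'a :: topological_space"
  assumes "depends_on N f"
  shows "continuous_on UNIV f"
  unfolding continuous_on_open_vimage[OF open_UNIV]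
proof (intro allI impI)
  fix B :: "'a set"
  have "f y = f x" if "y \<in> cyl x (int N)" for x y
    using assms that unfolding depends_on_def cyl_def by blast
  then have "f -` B \<inter> UNIV = (\<Union>x\<in>f -` B. cyl x (int N))"
    by (auto simp: cyl_def)
  then show "open (f -` B \<inter> UNIV)" by (simp only:) (intro open_UN ballI open_cyl)
qed

lemma continuous_walsh: "continuous_on UNIV (walsh k)"
  by (rule depends_on_imp_continuous[OF depends_on_walsh[OF less_exp]])

lemma borel_measurable_walsh [measurable]: "walsh k \<in> borel_measurable borel"
  by (rule borel_measurable_continuous_onI[OF continuous_walsh])

lemma borel_measurable_walsh' [measurable]: "walsh k \<in> borel_measurable haar_unit"
  by (rule borel_measurable_haar_unit) measurable

lemma unit_ball_add_unit_digit:
  assumes "j \<ge> 0"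
  shows "unit_digit j + x \<in> unit_ball \<longleftrightarrow> x \<in> unit_ball"
  using assms by (auto simp: unit_ball_eq_cyl cyl_def digit_unit_digit)

text \<open>If bit i distinguishes k from l, translation by \<open>unit_digit (int i)\<close>
  preserves Haar measure and the unit ball but negates the product, so the integral equals its own
  negative.\<close>

lemma integral_walsh_mult_walsh:
  "(\<integral>x. walsh k x * walsh l x \<partial>haar_unit) = of_bool (k = l)"
proof (cases "k = l")
  case True
  then show ?thesis by (simp add: walsh_mult_self)
next
  case False
  then obtain i where i: "bit k i \<noteq> bit l i" using bit_eq_iff by blast
  define e where "e = unit_digit (int i)"
  \<comment> \<open>The indicator is kept inside H because the invariance of \<open>haar\<close>
    concerns integrals over the whole group.\<close>
  define H where "H x = indicator unit_ball x *\<^sub>R (walsh k x * walsh l x)" for x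
  have [measurable]: "H \<in> borel_measurable borel"
    unfolding H_def using unit_ball_in_sets by (simp add: sets_haar)
  have neg: "H (e + x) = - H x" for x
    using i unit_ball_add_unit_digit[of "int i" x]
    by (auto simp: H_def e_def walsh_add walsh_unit_digit indicator_def)
  have "integral\<^sup>L haar H = integral\<^sup>L (distr haar borel (\<lambda>x. e + x)) H"
    using is_haar_haar by (simp add: is_haar_def)
  also have "\<dots> = (\<integral>x. H (e + x) \<partial>haar)" by (rule integral_distr) measurable
  also have "\<dots> = - integral\<^sup>L haar H" by (simp add: neg)
  finally have "integral\<^sup>L haar H = 0" by simp
  then show ?thesis
    using False unfolding haar_unit_def H_def by (subst integral_restrict_space) auto
qed

section \<open>Walsh coefficients and distributions built from them\<close>

definition walsh_coeff :: "(cantor \<Rightarrow> complex) \<Rightarrow> nat \<Rightarrow> complex" where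
  "walsh_coeff f k = (\<integral>x. f x * walsh k x \<partial>haar_unit)"

lemma integrable_mult_walsh:
  assumes "integrable haar_unit f"
  shows "integrable haar_unit (\<lambda>x. f x * walsh k x)"
  by (rule Bochner_Integration.integrable_bound[OF assms])
    (use assms in \<open>auto simp: norm_mult\<close>)

lemma integrable_walsh: "integrable haar_unit (walsh k)"
  by (rule integrable_haar_unitI[of _ 1]) auto

lemma walsh_coeff_walsh_sum:
  "walsh_coeff (\<lambda>x. \<Sum>k<K. c k * walsh k x) l = (if l < K then c l else 0)"
proof -
  have "walsh_coeff (\<lambda>x. \<Sum>k<K. c k * walsh k x) l = (\<integral>x. (\<Sum>k<K. c k * (walsh k x * walsh l x)) \<partial>haar_unit)"
    by (simp add: walsh_coeff_def sum_distrib_right mult.assoc)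
  also have "\<dots> = (\<Sum>k<K. c k * of_bool (k = l))"
    by (subst Bochner_Integration.integral_sum)
      (auto simp: integral_walsh_mult_walsh intro!: integrable_mult_walsh integrable_walsh)
  finally show ?thesis by simp
qed

text \<open>Coefficients recovered by integration make the value independent of how a test function
  is written as a Walsh polynomial; restricting to the non-zero ones makes the sum finite.\<close>

definition dist_of_coeffs :: "(nat \<Rightarrow> complex) \<Rightarrow> (cantor \<Rightarrow> complex) \<Rightarrow> complex" where
  "dist_of_coeffs a = (\<lambda>\<phi>\<in>test_P. \<Sum>k | walsh_coeff \<phi> k \<noteq> 0. walsh_coeff \<phi> k * a k)"

lemma dist_of_coeffs_walsh_sum:
  "dist_of_coeffs a (\<lambda>x. \<Sum>k<K. c k * walsh k x) = (\<Sum>k<K. c k * a k)"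
proof -
  have "dist_of_coeffs a (\<lambda>x. \<Sum>k<K. c k * walsh k x) =
      (\<Sum>k | (if k < K then c k else 0) \<noteq> 0. (if k < K then c k else 0) * a k)"
    by (simp add: dist_of_coeffs_def test_P_walsh_sum walsh_coeff_walsh_sum)
  also have "\<dots> = (\<Sum>k<K. c k * a k)" by (rule sum.mono_neutral_cong_left) auto
  finally show ?thesis .
qed

lemma dist_of_coeffs_walsh [simp]: "dist_of_coeffs a (walsh m) = a m"
  by (subst walsh_eq_sum, subst dist_of_coeffs_walsh_sum) (simp add: if_distrib)

lemma walsh_sum_extend:
  "(\<Sum>k<K. c k * walsh k x) = (\<Sum>k<K + L. (if k < K then c k else 0) * walsh k x)"
  by (rule sum.mono_neutral_cong_left) auto

text \<open>Continuity holds for coefficients of any growth: a null sequence has one common radius,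
  hence one level N, and stays in the span of the first \<open>2 ^ N\<close> Walsh functions, where
  only finitely many coefficients have to tend to 0.\<close>

lemma dist_of_coeffs_in_dist_P: "dist_of_coeffs a \<in> dist_P"
  unfolding dist_P_def
proof (intro CollectI conjI ballI allI impI)
  show "dist_of_coeffs a \<in> extensional test_P" by (simp add: dist_of_coeffs_def)
next
  fix \<phi> \<psi> assume "\<phi> \<in> test_P" "\<psi> \<in> test_P"
  then obtain K c L c' where KL: "\<phi> = (\<lambda>x. \<Sum>k<K. c k * walsh k x)" "\<psi> = (\<lambda>x. \<Sum>k<L. c' k * walsh k x)"
    unfolding test_P_iff by blast
  \<comment> \<open>Zero coefficients pad both polynomials to a common length.\<close>
  obtain M b b' where *: "\<phi> = (\<lambda>x. \<Sum>k<M. b k * walsh k x)" "\<psi> = (\<lambda>x. \<Sum>k<M. b' k * walsh k x)"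
  proof (rule that)
    show "\<phi> = (\<lambda>x. \<Sum>k<K + L. (if k < K then c k else 0) * walsh k x)"
      unfolding KL by (rule ext) (rule walsh_sum_extend)
    show "\<psi> = (\<lambda>x. \<Sum>k<K + L. (if k < L then c' k else 0) * walsh k x)"
      unfolding KL add.commute[of K L] by (rule ext) (rule walsh_sum_extend)
  qed
  have "(\<lambda>x. \<phi> x + \<psi> x) = (\<lambda>x. \<Sum>k<M. (b k + b' k) * walsh k x)"
    unfolding * by (simp add: sum.distrib distrib_right)
  then show "dist_of_coeffs a (\<lambda>x. \<phi> x + \<psi> x) = dist_of_coeffs a \<phi> + dist_of_coeffs a \<psi>"
    unfolding * by (simp only: dist_of_coeffs_walsh_sum) (simp add: sum.distrib distrib_right)
next
  fix c \<phi> assume "\<phi> \<in> test_P"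
  then obtain K b where *: "\<phi> = (\<lambda>x. \<Sum>k<K. b k * walsh k x)" unfolding test_P_iff by blast
  have "(\<lambda>x. c * \<phi> x) = (\<lambda>x. \<Sum>k<K. (c * b k) * walsh k x)"
    unfolding * by (simp add: sum_distrib_left mult.assoc)
  then show "dist_of_coeffs a (\<lambda>x. c * \<phi> x) = c * dist_of_coeffs a \<phi>"
    unfolding * by (simp only: dist_of_coeffs_walsh_sum) (simp add: sum_distrib_left mult.assoc)
next
  fix \<phi> assume "null_seq_P \<phi>"
  then obtain r where P: "\<And>j. \<phi> j \<in> test_P" and r: "r > 0" "\<And>j x. \<phi> j constant_on ball x r"
    and lim: "uniform_limit unit_ball \<phi> (\<lambda>_. 0) sequentially"
    unfolding null_seq_P_def by blast
  obtain N :: nat where N: "(1/2) ^ N < r" using real_arch_pow_inv[of r "1/2"] r by auto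
  have dep: "depends_on N (\<phi> j)" for j
  proof (rule depends_onI)
    show "periodic1 (\<phi> j)" using P by (simp add: test_P_def)
    fix x
    have "(2::real) powi (- int N) = (1/2) ^ N"
      by (simp add: power_int_minus power_one_over field_simps)
    then have "cyl x (int N) \<subseteq> ball x r" using N by (auto simp: cyl_eq_ball)
    then show "\<phi> j constant_on cyl x (int N)" using r(2) constant_on_subset by blast
  qed
  have val: "dist_of_coeffs a (\<phi> j) = (\<Sum>k<2^N. walsh_coeff (\<phi> j) k * a k)" for j
  proof -
    obtain c where c: "\<phi> j = (\<lambda>x. \<Sum>k<2^N. c k * walsh k x)" using depends_on_imp_walsh_sum[OF dep] by blast
    show ?thesis unfolding c by (simp add: dist_of_coeffs_walsh_sum walsh_coeff_walsh_sum)
  qed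
  have "(\<lambda>j. walsh_coeff (\<phi> j) k) \<longlonglongrightarrow> 0" for k
  proof (rule tendstoI)
    fix e :: real assume e: "e > 0"
    have "\<forall>\<^sub>F j in sequentially. \<forall>x\<in>unit_ball. dist (\<phi> j x) 0 < e / 2"
      using lim e unfolding uniform_limit_iff by (meson half_gt_zero)
    then show "\<forall>\<^sub>F j in sequentially. dist (walsh_coeff (\<phi> j) k) 0 < e"
    proof eventually_elim
      case (elim j)
      have "norm (walsh_coeff (\<phi> j) k) \<le> e / 2"
        unfolding walsh_coeff_def
        by (rule norm_integral_haar_unit_le) (use e elim in \<open>auto simp: norm_mult intro: less_imp_le\<close>)
      then show ?case using e by simp
    qed
  qed
  then have "(\<lambda>j. \<Sum>k<2^N. walsh_coeff (\<phi> j) k * a k) \<longlonglongrightarrow> (\<Sum>k<(2::nat)^N. 0 * a k)"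
    by (intro tendsto_intros)
  then show "(\<lambda>j. dist_of_coeffs a (\<phi> j)) \<longlonglongrightarrow> 0" by (simp add: val)
qed

lemma dist_of_coeffs_eqI: "F \<in> dist_P \<Longrightarrow> (\<And>k. F (walsh k) = a k) \<Longrightarrow> F = dist_of_coeffs a"
  by (rule dist_P_eqI) (simp_all add: dist_of_coeffs_walsh_sum, simp add: dist_of_coeffs_def)

lemma regular_dist_eqI:
  assumes F: "F \<in> dist_P" and u: "integrable haar_unit u" and eq: "\<And>k. walsh_coeff u k = F (walsh k)"
  shows "F = regular_dist u"
proof (rule dist_P_eqI[OF F])
  show "regular_dist u \<in> extensional test_P" by (simp add: regular_dist_def)
  fix K c
  have "regular_dist u (\<lambda>x. \<Sum>k<K. c k * walsh k x) = (\<integral>x. (\<Sum>k<K. c k * (u x * walsh k x)) \<partial>haar_unit)"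
    by (simp add: regular_dist_def test_P_walsh_sum set_lebesgue_integral_unit_ball sum_distrib_left mult_ac)
  also have "\<dots> = (\<Sum>k<K. c k * walsh_coeff u k)"
    by (subst Bochner_Integration.integral_sum)
      (auto simp: walsh_coeff_def intro!: integrable_mult_walsh u)
  finally show "regular_dist u (\<lambda>x. \<Sum>k<K. c k * walsh k x) = (\<Sum>k<K. c k * F (walsh k))" by (simp add: eq)
qed

section \<open>Regularity from coefficient decay\<close>

text \<open>Summable L1 norms make the sum of the norms integrable, hence finite almost everywhere;
  it then dominates the partial sums and permits termwise integration.\<close>

lemma
  fixes f :: "nat \<Rightarrow> cantor \<Rightarrow> complex"
  assumes int: "\<And>i. integrable haar_unit (f i)"
    and summ: "summable (\<lambda>i. \<integral>x. norm (f i x) \<partial>haar_unit)"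
  shows AE_summable_haar_unit: "AE x in haar_unit. summable (\<lambda>i. norm (f i x))"
    and integrable_suminf_haar_unit: "integrable haar_unit (\<lambda>x. \<Sum>i. f i x)"
    and walsh_coeff_suminf: "(\<lambda>i. walsh_coeff (f i) k) sums walsh_coeff (\<lambda>x. \<Sum>i. f i x) k"
proof -
  note [measurable] = borel_measurable_integrable[OF int]
  have "(\<integral>\<^sup>+x. (\<Sum>i. ennreal (norm (f i x))) \<partial>haar_unit) = (\<Sum>i. \<integral>\<^sup>+x. ennreal (norm (f i x)) \<partial>haar_unit)"
    by (rule nn_integral_suminf) measurable
  also have "\<dots> = (\<Sum>i. ennreal (\<integral>x. norm (f i x) \<partial>haar_unit))"
    using int by (subst nn_integral_eq_integral) auto
  also have "\<dots> \<noteq> \<infinity>"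
    unfolding infinity_ennreal_def by (rule ennreal_suminf_neq_top[OF summ]) simp
  finally have "AE x in haar_unit. (\<Sum>i. ennreal (norm (f i x))) \<noteq> \<infinity>"
    by (rule nn_integral_PInf_AE[rotated]) measurable
  then show AE: "AE x in haar_unit. summable (\<lambda>i. norm (f i x))"
    by eventually_elim (auto intro: summable_suminf_not_top)
  show "integrable haar_unit (\<lambda>x. \<Sum>i. f i x)"
    by (rule integrable_suminf[OF int AE summ])
  have "(\<lambda>i. walsh_coeff (f i) k) sums (\<integral>x. (\<Sum>i. f i x * walsh k x) \<partial>haar_unit)"
    unfolding walsh_coeff_def
    by (rule sums_integral) (use int AE summ in \<open>auto simp: norm_mult intro: integrable_mult_walsh\<close>)
  also have "(\<integral>x. (\<Sum>i. f i x * walsh k x) \<partial>haar_unit) = walsh_coeff (\<lambda>x. \<Sum>i. f i x) k"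
    unfolding walsh_coeff_def
  proof (rule integral_cong_AE)
    \<comment> \<open>Pulling the factor out of \<open>suminf\<close> uses convergence, so the
      equality is obtained almost everywhere.\<close>
    show "AE x in haar_unit. (\<Sum>i. f i x * walsh k x) = (\<Sum>i. f i x) * walsh k x"
      using AE by eventually_elim (auto intro: suminf_mult2[symmetric] summable_norm_cancel)
  qed measurable
  finally show "(\<lambda>i. walsh_coeff (f i) k) sums walsh_coeff (\<lambda>x. \<Sum>i. f i x) k" .
qed

text \<open>True even where the series diverges: corresponding terms agree at both points, so
  \<open>suminf\<close> is applied to the same sequence.\<close>

lemma periodic1_suminf: "(\<And>i. periodic1 (f i)) \<Longrightarrow> periodic1 (\<lambda>x. \<Sum>i. f i x)"
  by (simp add: periodic1_def)

lemma periodic1_walsh: "periodic1 (walsh k)"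
  using walsh_in_test_P by (simp add: test_P_def)

lemma integrable_walsh_sum: "integrable haar_unit (\<lambda>x. \<Sum>k\<in>A. a k * walsh k x)"
  by (intro Bochner_Integration.integrable_sum integrable_mult_right integrable_walsh)

text \<open>Parseval for finite sums. The square expands into a complex double sum, to which
  orthonormality applies, and the real claims are read back through
  \<open>complex_of_real\<close>.\<close>

lemma norm_power2_walsh_sum:
  assumes "finite A"
  shows "integrable haar_unit (\<lambda>x. (norm (\<Sum>k\<in>A. a k * walsh k x))\<^sup>2)"
    and "(\<integral>x. (norm (\<Sum>k\<in>A. a k * walsh k x))\<^sup>2 \<partial>haar_unit) = (\<Sum>k\<in>A. (norm (a k))\<^sup>2)"
proof -
  let ?g = "\<lambda>x. \<Sum>k\<in>A. \<Sum>l\<in>A. (a k * cnj (a l)) * (walsh k x * walsh l x)"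
  have eq: "complex_of_real ((norm (\<Sum>k\<in>A. a k * walsh k x))\<^sup>2) = ?g x" for x
    unfolding complex_norm_square cnj_sum sum_product by (simp add: mult_ac)
  have int: "integrable haar_unit (\<lambda>x. (a k * cnj (a l)) * (walsh k x * walsh l x))" for k l
    by (intro integrable_mult_right integrable_mult_walsh integrable_walsh)
  have "integrable haar_unit ?g" by (intro Bochner_Integration.integrable_sum int)
  then show "integrable haar_unit (\<lambda>x. (norm (\<Sum>k\<in>A. a k * walsh k x))\<^sup>2)"
    by (simp only: flip: eq) (simp only: complex_of_real_integrable_eq)
  have "complex_of_real (\<integral>x. (norm (\<Sum>k\<in>A. a k * walsh k x))\<^sup>2 \<partial>haar_unit) = integral\<^sup>L haar_unit ?g"
    by (simp only: flip: eq) (simp only: integral_complex_of_real)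
  also have "\<dots> = (\<Sum>k\<in>A. \<Sum>l\<in>A. (a k * cnj (a l)) * of_bool (k = l))"
    using int by (simp add: Bochner_Integration.integral_sum Bochner_Integration.integrable_sum integral_walsh_mult_walsh)
  also have "\<dots> = (\<Sum>k\<in>A. a k * cnj (a k))"
    using assms by (intro sum.cong refl) (simp add: if_distrib)
  also have "\<dots> = complex_of_real (\<Sum>k\<in>A. (norm (a k))\<^sup>2)"
    by (simp only: of_real_sum complex_norm_square)
  finally show "(\<integral>x. (norm (\<Sum>k\<in>A. a k * walsh k x))\<^sup>2 \<partial>haar_unit) = (\<Sum>k\<in>A. (norm (a k))\<^sup>2)"
    by (simp only: of_real_eq_iff)
qed

lemma walsh_coeff_monom: "walsh_coeff (\<lambda>x. c * walsh i x) k = (if k = i then c else 0)"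
  by (simp add: walsh_coeff_def mult.assoc integral_walsh_mult_walsh)

lemma summable_Suc_powr: "s > 1 \<Longrightarrow> summable (\<lambda>m. C * real (Suc m) powr (- s))"
  by (intro summable_mult, subst summable_Suc_iff) (simp add: summable_real_powr_iff)

text \<open>Since \<open>s > 1\<close>, the Weierstrass test gives uniform convergence of the Walsh
  series, which preserves continuity.\<close>

lemma C_P_of_coeffs:
  assumes F: "F \<in> dist_P" and bound: "\<And>m. norm (F (walsh m)) \<le> C * real (Suc m) powr (- s)" and "s > 1"
  shows "\<exists>u\<in>C_P. F = regular_dist u"
proof -
  define f where "f m x = F (walsh m) * walsh m x" for m x
  define u where "u x = (\<Sum>m. f m x)" for x
  have summ: "summable (\<lambda>m. norm (F (walsh m)))"
    by (rule summable_comparison_test'[OF summable_Suc_powr[OF \<open>s > 1\<close>, of C]]) (use bound in simp)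
  have norm_f: "norm (f m x) = norm (F (walsh m))" for m x by (simp add: f_def norm_mult)
  have "uniform_limit UNIV (\<lambda>n x. \<Sum>m<n. f m x) u sequentially"
    unfolding u_def by (rule Weierstrass_m_test[OF _ summ]) (simp add: norm_f)
  moreover have "\<forall>\<^sub>F n in sequentially. continuous_on UNIV (\<lambda>x. \<Sum>m<n. f m x)"
    unfolding f_def by (intro always_eventually allI continuous_intros continuous_walsh)
  ultimately have cont: "continuous_on UNIV u" by (intro uniform_limit_theorem) auto
  have per: "periodic1 u"
    unfolding u_def by (rule periodic1_suminf) (use periodic1_walsh in \<open>simp add: periodic1_def f_def\<close>)
  have int: "integrable haar_unit (f m)" for m
    unfolding f_def by (intro integrable_mult_right integrable_walsh)
  have summ': "summable (\<lambda>m. \<integral>x. norm (f m x) \<partial>haar_unit)" using summ by (simp add: norm_f)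
  have "F = regular_dist u"
  proof (rule regular_dist_eqI[OF F])
    show "integrable haar_unit u" unfolding u_def by (rule integrable_suminf_haar_unit[OF int summ'])
    fix k
    have "(\<lambda>m. walsh_coeff (f m) k) sums walsh_coeff u k"
      unfolding u_def by (rule walsh_coeff_suminf[OF int summ'])
    moreover have "(\<lambda>m. walsh_coeff (f m) k) = (\<lambda>m. if m = k then F (walsh m) else 0)"
      unfolding f_def walsh_coeff_monom by auto
    ultimately show "walsh_coeff u k = F (walsh k)" using sums_single[of k] sums_unique2 by metis
  qed
  moreover have "u \<in> C_P" using cont per by (simp add: C_P_def)
  ultimately show ?thesis by blast
qed

text \<open>The decay of the coefficients makes the \<open>L\<^sub>2\<close>-norms of the dyadic blocks geometrically small, so the
  series of blocks converges absolutely almost everywhere and no completeness theorem for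
  \<open>L\<^sub>2\<close> is needed.\<close>

lemma L2_P_of_coeffs:
  assumes F: "F \<in> dist_P" and bound: "\<And>m. norm (F (walsh m)) \<le> C * real (Suc m) powr (- s)" and s: "s > 1/2"
  shows "\<exists>u\<in>L2_P. F = regular_dist u"
proof -
  define a where "a m = F (walsh m)" for m
  \<comment> \<open>Shifted by one from the usual dyadic blocks: they begin at index 0, and their
    members satisfy \<open>2 ^ i \<le> Suc k\<close>, which suits the bound in
    \<open>Suc m\<close>.\<close>
  define B where "B i = {2^i - 1..<2^Suc i - 1 :: nat}" for i
  define f where "f i x = (\<Sum>k\<in>B i. a k * walsh k x)" for i x
  define u where "u x = (\<Sum>i. f i x)" for x
  \<comment> \<open>A block has \<open>2 ^ i\<close> coefficients, each of norm at most
    \<open>C * 2 powr (- s * real i)\<close>, so its L2 norm is at most \<open>C * q ^ i\<close>;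
    \<open>s > 1/2\<close> makes \<open>q < 1\<close>.\<close>
  define q where "q = 2 powr (1/2 - s)"
  have q: "0 < q" "q < 1" using s powr_less_mono[of "1/2 - s" 0 2] by (auto simp: q_def)
  have "0 \<le> C" using order_trans[OF norm_ge_zero bound[of 0]] by simp
  have [measurable]: "f i \<in> borel_measurable borel" for i unfolding f_def by measurable
  then have [measurable]: "f i \<in> borel_measurable haar_unit" for i by (rule borel_measurable_haar_unit)
  have int: "integrable haar_unit (f i)" for i unfolding f_def by (rule integrable_walsh_sum)
  have partial: "(\<Sum>i<n. f i x) = (\<Sum>k<2^n - 1. a k * walsh k x)" for n x
  proof (induction n)
    case (Suc n)
    have "(\<Sum>k<2^n - 1. a k * walsh k x) + f n x = (\<Sum>k<2^Suc n - 1. a k * walsh k x)"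
      unfolding f_def B_def lessThan_atLeast0 by (rule sum.atLeastLessThan_concat) auto
    then show ?case using Suc by simp
  qed simp
  have L2_block: "(\<integral>x. (norm (f i x))\<^sup>2 \<partial>haar_unit) \<le> C\<^sup>2 * (q ^ i)\<^sup>2" for i
  proof -
    have "(norm (a k))\<^sup>2 \<le> C\<^sup>2 * (2 powr (- s * real i))\<^sup>2" if "k \<in> B i" for k
    proof -
      have "(2::nat) ^ i \<le> Suc k" using that by (auto simp: B_def)
      then have "(2::real) ^ i \<le> real (Suc k)" by (metis of_nat_le_iff of_nat_numeral of_nat_power)
      then have "real (Suc k) powr (- s) \<le> (2 ^ i) powr (- s)"
        using s by (intro powr_mono2') auto
      also have "\<dots> = 2 powr (- s * real i)"
        by (simp add: powr_powr mult.commute flip: powr_realpow)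
      finally have "norm (a k) \<le> C * 2 powr (- s * real i)"
        using bound[of k] \<open>0 \<le> C\<close> unfolding a_def by (meson mult_left_mono order_trans)
      then have "(norm (a k))\<^sup>2 \<le> (C * 2 powr (- s * real i))\<^sup>2" by (intro power_mono) auto
      then show ?thesis by (simp add: power_mult_distrib)
    qed
    then have "(\<Sum>k\<in>B i. (norm (a k))\<^sup>2) \<le> real (card (B i)) * (C\<^sup>2 * (2 powr (- s * real i))\<^sup>2)"
      by (intro sum_bounded_above) auto
    also have "real (card (B i)) = 2 ^ i" by (simp add: B_def)
    also have "2 ^ i * (C\<^sup>2 * (2 powr (- s * real i))\<^sup>2) = C\<^sup>2 * (q ^ i)\<^sup>2"
    proof -
      have "(q ^ i)\<^sup>2 = 2 powr ((1/2 - s) * real i * 2)"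
        by (simp add: q_def powr_powr mult_ac flip: powr_realpow powr_numeral)
      also have "(1/2 - s) * real i * 2 = real i + - s * real i * 2" by (simp add: algebra_simps)
      also have "2 powr (real i + - s * real i * 2) = 2 powr real i * 2 powr (- s * real i * 2)"
        by (rule powr_add)
      also have "\<dots> = 2 ^ i * (2 powr (- s * real i))\<^sup>2"
        by (simp add: powr_powr powr_realpow flip: powr_numeral)
      finally show ?thesis by simp
    qed
    finally show ?thesis
      unfolding f_def using norm_power2_walsh_sum(2)[of "B i" a] by (simp add: B_def)
  qed
  have L1_block: "(\<integral>x. norm (f i x) \<partial>haar_unit) \<le> (1 + C\<^sup>2) / 2 * q ^ i" for i
  proof -
    have qi: "q ^ i > 0" using q by simp
    have int2: "integrable haar_unit (\<lambda>x. (norm (f i x))\<^sup>2)"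
      unfolding f_def by (rule norm_power2_walsh_sum) (simp add: B_def)
    note [simp] = finite_measure.integrable_const[OF finite_measure_haar_unit]
    \<comment> \<open>AM-GM in the role of Cauchy-Schwarz: the weight \<open>q ^ i\<close> balances
      both terms, so the L1 norm keeps the rate \<open>q ^ i\<close>.\<close>
    have amgm: "y \<le> (q ^ i + y\<^sup>2 / q ^ i) / 2" for y
    proof -
      have "0 \<le> (y - q ^ i)\<^sup>2" by simp
      then have "2 * y * q ^ i \<le> q ^ i * q ^ i + y\<^sup>2" by (simp add: power2_eq_square algebra_simps)
      then have "2 * y \<le> (q ^ i * q ^ i + y\<^sup>2) / q ^ i" using qi by (simp add: pos_le_divide_eq)
      also have "\<dots> = q ^ i + y\<^sup>2 / q ^ i" using qi by (simp add: add_divide_distrib)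
      finally show ?thesis by simp
    qed
    have "(\<integral>x. norm (f i x) \<partial>haar_unit) \<le> (\<integral>x. (q ^ i + (norm (f i x))\<^sup>2 / q ^ i) / 2 \<partial>haar_unit)"
      using int int2 amgm by (intro integral_mono) auto
    also have "\<dots> = (q ^ i + (\<integral>x. (norm (f i x))\<^sup>2 \<partial>haar_unit) / q ^ i) / 2"
      using int2 by simp
    also have "\<dots> \<le> (q ^ i + C\<^sup>2 * (q ^ i)\<^sup>2 / q ^ i) / 2"
      using qi L2_block[of i] by (intro divide_right_mono add_left_mono) auto
    also have "\<dots> = (1 + C\<^sup>2) / 2 * q ^ i" using qi by (simp add: power2_eq_square field_simps)
    finally show ?thesis .
  qed
  have summ: "summable (\<lambda>i. \<integral>x. norm (f i x) \<partial>haar_unit)"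
  proof (rule summable_comparison_test')
    show "summable (\<lambda>i. (1 + C\<^sup>2) / 2 * q ^ i)" using q by (intro summable_mult summable_geometric) auto
    show "norm (\<integral>x. norm (f i x) \<partial>haar_unit) \<le> (1 + C\<^sup>2) / 2 * q ^ i" for i
      using L1_block[of i] by (simp add: Bochner_Integration.integral_nonneg)
  qed
  have coeff: "walsh_coeff u k = a k" for k
  proof -
    \<comment> \<open>The sums are stationary once the blocks have passed k:
      \<open>Suc k \<le> 2 ^ k < 2 ^ n\<close> gives \<open>k < 2 ^ n - 1\<close>.\<close>
    have "(\<Sum>i<n. walsh_coeff (f i) k) = a k" if "n \<ge> Suc k" for n
    proof -
      have "k < 2 ^ k" by (rule less_exp)
      also have "(2::nat) ^ k < 2 ^ n" using that by simp
      finally have k: "k < 2 ^ n - 1"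
        using \<open>k < 2 ^ k\<close> \<open>(2::nat) ^ k < 2 ^ n\<close> by linarith
      have "(\<Sum>i<n. walsh_coeff (f i) k) = walsh_coeff (\<lambda>x. \<Sum>i<n. f i x) k"
        unfolding walsh_coeff_def sum_distrib_right
        by (rule Bochner_Integration.integral_sum[symmetric]) (rule integrable_mult_walsh[OF int])
      also have "\<dots> = a k" unfolding partial walsh_coeff_walsh_sum using k by simp
      finally show ?thesis .
    qed
    then have "(\<lambda>i. walsh_coeff (f i) k) sums a k"
      unfolding sums_def by (intro tendsto_eventually) (auto simp: eventually_sequentially)
    moreover have "(\<lambda>i. walsh_coeff (f i) k) sums walsh_coeff u k"
      unfolding u_def by (rule walsh_coeff_suminf[OF int summ])
    ultimately show ?thesis by (rule sums_unique2[symmetric])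
  qed
  have int_u: "integrable haar_unit u" unfolding u_def by (rule integrable_suminf_haar_unit[OF int summ])
  have "F = regular_dist u"
    by (rule regular_dist_eqI[OF F int_u]) (simp add: coeff a_def)
  moreover have "u \<in> L2_P"
  proof -
    have per: "periodic1 u"
      unfolding u_def f_def
      by (intro periodic1_suminf) (use periodic1_walsh in \<open>simp add: periodic1_def\<close>)
    have [measurable]: "u \<in> borel_measurable borel" unfolding u_def by measurable
    then have meas: "u \<in> borel_measurable haar_unit" by (rule borel_measurable_haar_unit)
    define D where "D = (\<Sum>m. (C * real (Suc m) powr (- s))\<^sup>2)"
    have "(C * real (Suc m) powr (- s))\<^sup>2 = C\<^sup>2 * real (Suc m) powr (- (2 * s))" for m
      by (simp add: power_mult_distrib powr_powr mult.commute flip: powr_numeral)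
    then have summ2: "summable (\<lambda>m. (C * real (Suc m) powr (- s))\<^sup>2)"
      using summable_Suc_powr[of "2 * s" "C\<^sup>2"] s by simp
    have S: "(\<integral>\<^sup>+x. ennreal ((norm (\<Sum>i<n. f i x))\<^sup>2) \<partial>haar_unit) \<le> ennreal D" for n
    proof -
      have "(\<integral>\<^sup>+x. ennreal ((norm (\<Sum>i<n. f i x))\<^sup>2) \<partial>haar_unit) = ennreal (\<Sum>k<2^n - 1. (norm (a k))\<^sup>2)"
        unfolding partial
        by (subst nn_integral_eq_integral) (simp_all add: norm_power2_walsh_sum)
      also have "(\<Sum>k<2^n - 1. (norm (a k))\<^sup>2) \<le> (\<Sum>k<2^n - 1. (C * real (Suc k) powr (- s))\<^sup>2)"
        unfolding a_def by (intro sum_mono power_mono bound) simp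
      also have "\<dots> \<le> D" unfolding D_def by (rule sum_le_suminf[OF summ2]) auto
      finally show ?thesis by (simp add: ennreal_leI)
    qed
    \<comment> \<open>Fatou's lemma: u is the almost everywhere limit of the partial sums, whose
      squared L2 norms are bounded by D.\<close>
    have "(\<integral>\<^sup>+x. ennreal ((norm (u x))\<^sup>2) \<partial>haar_unit) =
        (\<integral>\<^sup>+x. liminf (\<lambda>n. ennreal ((norm (\<Sum>i<n. f i x))\<^sup>2)) \<partial>haar_unit)"
    proof (rule nn_integral_cong_AE)
      show "AE x in haar_unit. ennreal ((norm (u x))\<^sup>2) = liminf (\<lambda>n. ennreal ((norm (\<Sum>i<n. f i x))\<^sup>2))"
        using AE_summable_haar_unit[OF int summ]
      proof eventually_elim
        case (elim x)
        then have "(\<lambda>n. \<Sum>i<n. f i x) \<longlonglongrightarrow> u x"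
          unfolding u_def by (rule summable_LIMSEQ[OF summable_norm_cancel])
        then have "(\<lambda>n. ennreal ((norm (\<Sum>i<n. f i x))\<^sup>2)) \<longlonglongrightarrow> ennreal ((norm (u x))\<^sup>2)"
          by (intro tendsto_intros)
        then show ?case by (rule lim_imp_Liminf[OF sequentially_bot, symmetric])
      qed
    qed
    also have "\<dots> \<le> liminf (\<lambda>n. \<integral>\<^sup>+x. ennreal ((norm (\<Sum>i<n. f i x))\<^sup>2) \<partial>haar_unit)"
      by (rule nn_integral_liminf) measurable
    also have "\<dots> \<le> liminf (\<lambda>n::nat. ennreal D)" by (intro Liminf_mono always_eventually allI S)
    also have "\<dots> = ennreal D" by (simp add: Liminf_const)
    finally have "integrable haar_unit (\<lambda>x. (norm (u x))\<^sup>2)"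
      using meas by (intro integrableI_bounded) (auto simp: le_less_trans)
    then have "set_integrable haar unit_ball (\<lambda>x. (norm (u x))\<^sup>2)"
      unfolding set_integrable_def haar_unit_def by (subst (asm) integrable_restrict_space) simp_all
    moreover have "set_borel_measurable haar unit_ball u"
      using meas unfolding set_borel_measurable_def haar_unit_def
      by (subst (asm) borel_measurable_restrict_space_iff) simp_all
    ultimately show ?thesis using per by (simp add: L2_P_def)
  qed
  ultimately show ?thesis by blast
qed

section \<open>Growth of the characteristic polynomial and decay of solutions\<close>

lemma poly_charpoly: "poly (charpoly n \<alpha>) x = (\<Sum>k\<le>n. \<alpha> k * x ^ k)"
  by (simp add: charpoly_def poly_sum poly_monom)

lemma charpoly_nonzero: "\<alpha> n \<noteq> 0 \<Longrightarrow> charpoly n \<alpha> \<noteq> 0"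
  by (auto simp: charpoly_def poly_eq_iff coeff_sum intro!: exI[of _ n])

lemma tendsto_charpoly_div_power:
  "(\<lambda>m. poly (charpoly n \<alpha>) (of_nat m) / of_nat m ^ n) \<longlonglongrightarrow> \<alpha> n"
proof -
  have "(\<lambda>m. of_nat m ^ k / of_nat m ^ n :: complex) \<longlonglongrightarrow> of_bool (k = n)" if "k \<le> n" for k
  proof (cases "k = n")
    case True
    then show ?thesis
      by (intro tendsto_eventually) (auto simp: eventually_sequentially intro!: exI[of _ 1])
  next
    case False
    have "(\<lambda>m. inverse (of_nat m) ^ (n - k) :: complex) \<longlonglongrightarrow> 0 ^ (n - k)"
      by (intro tendsto_power lim_inverse_n)
    moreover have "inverse (of_nat m) ^ (n - k) = (of_nat m ^ k / of_nat m ^ n :: complex)" if "m \<ge> 1" for m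
      using \<open>k \<le> n\<close> that by (simp add: power_diff field_simps power_inverse)
    then have "\<forall>\<^sub>F m in sequentially. inverse (of_nat m) ^ (n - k) = (of_nat m ^ k / of_nat m ^ n :: complex)"
      unfolding eventually_sequentially by blast
    ultimately have "(\<lambda>m. of_nat m ^ k / of_nat m ^ n :: complex) \<longlonglongrightarrow> 0 ^ (n - k)"
      by (rule Lim_transform_eventually)
    then show ?thesis using False \<open>k \<le> n\<close> by (simp add: power_0_left)
  qed
  then have "(\<lambda>m. \<Sum>k\<le>n. \<alpha> k * (of_nat m ^ k / of_nat m ^ n)) \<longlonglongrightarrow> (\<Sum>k\<le>n. \<alpha> k * of_bool (k = n))"
    by (intro tendsto_sum tendsto_mult_left) auto
  then show ?thesis by (simp add: poly_charpoly sum_divide_distrib)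
qed

text \<open>Eventually the polynomial exceeds half its leading term in norm, and dividing leaves the
  exponent \<open>- s\<close>. Writing the bound with \<open>Suc m\<close> keeps the power positive
  at \<open>m = 0\<close>.\<close>

lemma coeff_decay:
  assumes "\<alpha> n \<noteq> 0" and eq: "\<And>m. poly (charpoly n \<alpha>) (of_nat m) * a m = d m"
    and d: "d \<in> O(\<lambda>m. of_real (real m powr (real n - s)))" and "s > 0"
  shows "\<exists>C. \<forall>m. norm (a m) \<le> C * real (Suc m) powr (- s)"
proof -
  let ?Q = "\<lambda>m. poly (charpoly n \<alpha>) (of_nat m)"
  obtain c where c: "c > 0" "\<forall>\<^sub>F m in sequentially. norm (d m) \<le> c * (real m powr (real n - s))"
    using landau_o.bigE[OF d] by auto
  have "(\<lambda>m. norm (?Q m / of_nat m ^ n)) \<longlonglongrightarrow> norm (\<alpha> n)"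
    by (intro tendsto_norm tendsto_charpoly_div_power)
  then have "\<forall>\<^sub>F m in sequentially. norm (\<alpha> n) / 2 < norm (?Q m / of_nat m ^ n)"
    using assms(1) by (intro order_tendstoD(1)) auto
  with c(2) eventually_ge_at_top[of 1]
  have "\<forall>\<^sub>F m in sequentially. norm (a m) \<le> 2 * c / norm (\<alpha> n) * 2 powr s * real (Suc m) powr (- s)"
  proof eventually_elim
    case (elim m)
    have "norm (\<alpha> n) / 2 * real m powr real n * norm (a m) \<le> norm (?Q m) * norm (a m)"
      using elim by (intro mult_right_mono) (auto simp: norm_divide norm_power powr_realpow field_simps)
    also have "\<dots> \<le> c * (real m powr (real n - s))" using elim(1) eq[of m] by (simp flip: norm_mult)
    also have "\<dots> = c * real m powr (- s) * real m powr real n"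
      by (simp add: powr_diff powr_minus field_simps)
    finally have "norm (\<alpha> n) / 2 * norm (a m) \<le> c * real m powr (- s)"
      using elim by (simp add: mult_ac powr_realpow flip: of_nat_power)
    then have "norm (a m) \<le> 2 * c / norm (\<alpha> n) * real m powr (- s)"
      using assms(1) by (simp add: field_simps)
    \<comment> \<open>Passing from m to \<open>Suc m\<close> costs the factor
      \<open>2 powr s\<close>, as \<open>m \<ge> Suc m / 2\<close> for
      \<open>m \<ge> 1\<close>.\<close>
    also have "real m powr (- s) \<le> (real (Suc m) / 2) powr (- s)"
      using elim \<open>s > 0\<close> by (intro powr_mono2') auto
    also have "\<dots> = 2 powr s * real (Suc m) powr (- s)"
      by (subst powr_divide) (simp_all add: powr_minus field_simps)
    finally show ?case using c(1) by (simp add: mult_left_mono mult.assoc divide_right_mono)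
  qed
  then obtain M where M: "\<And>m. m \<ge> M \<Longrightarrow>
      norm (a m) \<le> 2 * c / norm (\<alpha> n) * 2 powr s * real (Suc m) powr (- s)"
    unfolding eventually_sequentially by blast
  \<comment> \<open>The finite sum majorises each initial term, whether or not the equation
    determines it.\<close>
  define C where "C = 2 * c / norm (\<alpha> n) * 2 powr s + (\<Sum>m<M. norm (a m) * real (Suc m) powr s)"
  have nonneg: "0 \<le> 2 * c / norm (\<alpha> n) * 2 powr s" using c(1) by simp
  have "norm (a m) \<le> C * real (Suc m) powr (- s)" for m
  proof (cases "m \<ge> M")
    case True
    have "2 * c / norm (\<alpha> n) * 2 powr s \<le> C" unfolding C_def by (simp add: sum_nonneg)
    then show ?thesis using M[OF True] by (meson mult_right_mono order_trans powr_ge_zero)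
  next
    case False
    then have "norm (a m) * real (Suc m) powr s \<le> (\<Sum>m<M. norm (a m) * real (Suc m) powr s)"
      by (intro member_le_sum) auto
    then have "norm (a m) * real (Suc m) powr s \<le> C" using nonneg unfolding C_def by linarith
    then show ?thesis by (simp add: powr_minus field_simps del: of_nat_Suc)
  qed
  then show ?thesis by blast
qed

text \<open>Parameters are extensional functions on R: their values off R are pinned, so the
  bijection expresses exactly one free complex number per root.\<close>

theorem theorem2:
  fixes n :: nat and \<alpha> d :: "nat \<Rightarrow> complex"
    and g :: "(cantor \<Rightarrow> complex) \<Rightarrow> complex"
    and Q :: "complex poly" and R :: "nat set"
  assumes "n \<ge> 1" and "\<alpha> n \<noteq> 0" and "has_walsh_rep g d"
    and "Q = charpoly n \<alpha>" and "R = {m. poly Q (of_nat m) = 0}"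
  shows
    "(R = {} \<longrightarrow>
        (\<exists>f. solutions n \<alpha> g = {f} \<and> has_walsh_rep f (\<lambda>m. d m / poly Q (of_nat m)))) \<and>
     (R \<noteq> {} \<and> (\<Sum>m\<in>R. cmod (d m)) = 0 \<longrightarrow>
        (\<exists>f. bij_betw f (R \<rightarrow>\<^sub>E (UNIV :: complex set)) (solutions n \<alpha> g) \<and>
             (\<forall>c \<in> R \<rightarrow>\<^sub>E UNIV.
                has_walsh_rep (f c) (\<lambda>m. if m \<in> R then c m else d m / poly Q (of_nat m))))) \<and>
     (R \<noteq> {} \<and> (\<Sum>m\<in>R. cmod (d m)) \<noteq> 0 \<longrightarrow> solutions n \<alpha> g = {}) \<and>
     ((\<exists>\<epsilon>>0. d \<in> O(\<lambda>m. of_real (real m powr (real n - 1/2 - \<epsilon>)))) \<longrightarrow>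
        (\<forall>f \<in> solutions n \<alpha> g. \<exists>u \<in> L2_P. f = regular_dist u)) \<and>
     ((\<exists>\<epsilon>>0. d \<in> O(\<lambda>m. of_real (real m powr (real n - 1 - \<epsilon>)))) \<longrightarrow>
        (\<forall>f \<in> solutions n \<alpha> g. \<exists>u \<in> C_P. f = regular_dist u))"
proof (intro conjI impI ballI)
  have sol: "F \<in> solutions n \<alpha> g \<longleftrightarrow> F \<in> dist_P \<and> (\<forall>m. poly Q (of_nat m) * F (walsh m) = d m)" for F
    using solutions_iff[OF assms(3)] assms(4) by simp
  have "Q \<noteq> 0" using charpoly_nonzero[of \<alpha> n] assms(2) assms(4) by simp
  \<comment> \<open>A sum over an infinite index set is 0 by default; finiteness of R is what lets a
    vanishing sum force every \<open>d m\<close> with m in R to vanish.\<close>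
  have finR: "finite R"
    using finite_vimageI[OF poly_roots_finite[OF \<open>Q \<noteq> 0\<close>] inj_of_nat] unfolding assms(5) by (simp add: vimage_def)
  define f where "f c = dist_of_coeffs (\<lambda>m. if m \<in> R then c m else d m / poly Q (of_nat m))" for c
  have rep: "has_walsh_rep (f c) (\<lambda>m. if m \<in> R then c m else d m / poly Q (of_nat m))" for c
    by (simp add: has_walsh_rep_def f_def dist_of_coeffs_in_dist_P)
  have f_sol: "f c \<in> solutions n \<alpha> g" if "\<And>m. m \<in> R \<Longrightarrow> d m = 0" for c
    unfolding sol using rep[of c] that assms(5) by (auto simp: has_walsh_rep_def)
  \<comment> \<open>Off R the scalar equation forces the quotient, so a solution is the family
    member whose parameters are its own coefficients at the roots.\<close>
  have sol_f: "F = f (\<lambda>m\<in>R. F (walsh m))" if "F \<in> solutions n \<alpha> g" for F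
    unfolding f_def by (rule dist_of_coeffs_eqI) (use that sol[of F] assms(5) in \<open>auto simp: field_simps\<close>)
  {
    assume "R = {}"
    \<comment> \<open>With R empty, f ignores its argument, so \<open>undefined\<close> serves as an
      arbitrary parameter.\<close>
    then have "solutions n \<alpha> g = {f undefined}"
    proof (intro equalityI subsetI)
      have f_const: "f c = f undefined" for c using \<open>R = {}\<close> by (simp add: f_def)
      fix F assume "F \<in> solutions n \<alpha> g"
      from sol_f[OF this] have "F = f undefined" by (rule trans) (rule f_const)
      then show "F \<in> {f undefined}" by simp
    qed (use f_sol \<open>R = {}\<close> in auto)
    then show "\<exists>f. solutions n \<alpha> g = {f} \<and> has_walsh_rep f (\<lambda>m. d m / poly Q (of_nat m))"
      using rep[of undefined] \<open>R = {}\<close> by auto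
  next
    assume "R \<noteq> {} \<and> (\<Sum>m\<in>R. cmod (d m)) = 0"
    then have d0: "d m = 0" if "m \<in> R" for m
      using finR that by (simp add: sum_nonneg_eq_0_iff)
    have "bij_betw f (R \<rightarrow>\<^sub>E (UNIV :: complex set)) (solutions n \<alpha> g)"
    proof (rule bij_betw_imageI)
      show "inj_on f (R \<rightarrow>\<^sub>E UNIV)"
      proof (rule inj_onI)
        fix c c' :: "nat \<Rightarrow> complex"
        assume c: "c \<in> R \<rightarrow>\<^sub>E UNIV" "c' \<in> R \<rightarrow>\<^sub>E UNIV" and eq: "f c = f c'"
        show "c = c'"
        proof (rule PiE_ext[OF c])
          fix m assume m: "m \<in> R"
          have "f c (walsh m) = f c' (walsh m)" using eq by simp
          then show "c m = c' m" using m by (simp add: f_def)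
        qed
      qed
      show "f ` (R \<rightarrow>\<^sub>E UNIV) = solutions n \<alpha> g"
      proof (intro equalityI subsetI)
        fix F assume F: "F \<in> solutions n \<alpha> g"
        show "F \<in> f ` (R \<rightarrow>\<^sub>E UNIV)"
          by (rule image_eqI[where f = f and x = "\<lambda>m\<in>R. F (walsh m)", OF sol_f[OF F]]) auto
      qed (use f_sol[OF d0] in auto)
    qed
    then show "\<exists>f. bij_betw f (R \<rightarrow>\<^sub>E (UNIV :: complex set)) (solutions n \<alpha> g) \<and>
        (\<forall>c \<in> R \<rightarrow>\<^sub>E UNIV. has_walsh_rep (f c) (\<lambda>m. if m \<in> R then c m else d m / poly Q (of_nat m)))"
      using rep by blast
  next
    assume "R \<noteq> {} \<and> (\<Sum>m\<in>R. cmod (d m)) \<noteq> 0"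
    then obtain m where "m \<in> R" "d m \<noteq> 0" by (metis norm_zero sum.neutral)
    then show "solutions n \<alpha> g = {}" using sol assms(5) by (metis (mono_tags) equals0I mem_Collect_eq mult_zero_left)
  next
    fix F assume "\<exists>\<epsilon>>0. d \<in> O(\<lambda>m. of_real (real m powr (real n - 1/2 - \<epsilon>)))" and F: "F \<in> solutions n \<alpha> g"
    then obtain \<epsilon> where \<epsilon>: "\<epsilon> > 0" "d \<in> O(\<lambda>m. of_real (real m powr (real n - (1/2 + \<epsilon>))))"
      by (auto simp: algebra_simps)
    obtain C where "\<And>m. norm (F (walsh m)) \<le> C * real (Suc m) powr (- (1/2 + \<epsilon>))"
      using coeff_decay[of \<alpha> n "\<lambda>m. F (walsh m)" d "1/2 + \<epsilon>"] sol F \<epsilon> assms(2,4) by auto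
    then show "\<exists>u \<in> L2_P. F = regular_dist u"
      using L2_P_of_coeffs sol F \<epsilon>(1) by (metis less_add_same_cancel1)
  next
    fix F assume "\<exists>\<epsilon>>0. d \<in> O(\<lambda>m. of_real (real m powr (real n - 1 - \<epsilon>)))" and F: "F \<in> solutions n \<alpha> g"
    then obtain \<epsilon> where \<epsilon>: "\<epsilon> > 0" "d \<in> O(\<lambda>m. of_real (real m powr (real n - (1 + \<epsilon>))))"
      by (auto simp: algebra_simps)
    obtain C where "\<And>m. norm (F (walsh m)) \<le> C * real (Suc m) powr (- (1 + \<epsilon>))"
      using coeff_decay[of \<alpha> n "\<lambda>m. F (walsh m)" d "1 + \<epsilon>"] sol F \<epsilon> assms(2,4) by auto
    then show "\<exists>u \<in> C_P. F = regular_dist u"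
      using C_P_of_coeffs sol F \<epsilon>(1) by (metis less_add_same_cancel1)
  }
qed

end
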